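(* There exist finite ranked posets $\Gamma$ for which the associated graded $\mathrm{gr}(\mathrm{Ext}_{A_\Gamma}(\mathbb{F},\mathbb{F}))$ is not isomorphic (as a bigraded vector space) to $\mathrm{Ext}_{A'_\Gamma}(\mathbb{F},\mathbb{F})$, and $\mathrm{gr}(\mathrm{Tor}^{A_\Gamma}(\mathbb{F},\mathbb{F}))$ is not isomorphic to $\mathrm{Tor}^{A'_\Gamma}(\mathbb{F},\mathbb{F})$.
   Context: Fix a field $\mathbb{F}$. A finite ranked poset is a finite poset $\Gamma$ with a unique minimal element $*$ such that for every $x$ all maximal chains in $[*,x]$ have the same length $rk(x)$. $x$ covers $y$ ($x\to y$) if $y<x$ and $rk(x)-rk(y)=1$; these are the edges. Let $W$ be the $\mathbb{F}$-vector space with basis the edges, $T(W)$ the free algebra on $W$. For $a<b$, $\Pi(b,a)$ is the set of paths $b=c_0\to\cdots\to c_n=a$; for such a path $\pi$ with edges $e_1,\dots,e_n$ define $e(\pi,j)$ by $(s-e_1)\cdots(s-e_n)=\sum_j e(\pi,j)s^{n-j}$, $s$ a central indeterminate. The splitting algebra is $A_\Gamma=T(W)/I$, $I$ generated by all $e(\pi,j)-e(\pi',j)$ with $\pi,\pi'\in\Pi(b,a)$, $a<b$, $0\le j\le n$; it is graded with edges in degree 1. An edge $x\to y$ has rank $rk(x)$; $F^nA_\Gamma$ is the span of images of products of edges whose ranks sum to at most $n$; $A'_\Gamma$ is the associated graded algebra (keeping the grading by degree). This filtration induces filtrations on $\mathrm{Ext}_{A_\Gamma}(\mathbb{F},\mathbb{F})$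 and $\mathrm{Tor}^{A_\Gamma}(\mathbb{F},\mathbb{F})$ (trivial module $\mathbb{F}$), whose associated graded objects are denoted $\mathrm{gr}(\cdot)$; Ext and Tor are bigraded by homological and internal degree. *)

theory Defs
  imports Main HOL.Vector_Spaces "HOL-Library.Function_Algebras" "HOL-Library.Groups_Big_Fun"
begin

type_synonym edge = "nat \<times> nat"
type_synonym word = "edge list"
type_synonym tuple = "word list"

definition is_poset :: "nat set \<Rightarrow> (nat \<Rightarrow> nat \<Rightarrow> bool) \<Rightarrow> bool" where
  "is_poset V le \<longleftrightarrow> (\<forall>x\<in>V. le x x) \<and> (\<forall>x\<in>V. \<forall>y\<in>V. le x y \<and> le y x \<longrightarrow> x = y)
     \<and> (\<forall>x\<in>V. \<forall>y\<in>V. \<forall>z\<in>V. le x y \<and> le y z \<longrightarrow> le x z)"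

definition lt :: "(nat \<Rightarrow> nat \<Rightarrow> bool) \<Rightarrow> nat \<Rightarrow> nat \<Rightarrow> bool" where
  "lt le x y \<longleftrightarrow> le x y \<and> x \<noteq> y"

definition is_minimal :: "nat set \<Rightarrow> (nat \<Rightarrow> nat \<Rightarrow> bool) \<Rightarrow> nat \<Rightarrow> bool" where
  "is_minimal V le m \<longleftrightarrow> m \<in> V \<and> (\<forall>y\<in>V. le y m \<longrightarrow> y = m)"

definition interval :: "nat set \<Rightarrow> (nat \<Rightarrow> nat \<Rightarrow> bool) \<Rightarrow> nat \<Rightarrow> nat \<Rightarrow> nat set" where
  "interval V le a b = {z \<in> V. le a z \<and> le z b}"

definition is_chain :: "(nat \<Rightarrow> nat \<Rightarrow> bool) \<Rightarrow> nat set \<Rightarrow> bool" where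
  "is_chain le C \<longleftrightarrow> (\<forall>x\<in>C. \<forall>y\<in>C. le x y \<or> le y x)"

definition maximal_chain_in :: "(nat \<Rightarrow> nat \<Rightarrow> bool) \<Rightarrow> nat set \<Rightarrow> nat set \<Rightarrow> bool" where
  "maximal_chain_in le S C \<longleftrightarrow> C \<subseteq> S \<and> is_chain le C \<and>
     (\<forall>D. D \<subseteq> S \<and> is_chain le D \<and> C \<subseteq> D \<longrightarrow> D = C)"

text \<open>The length of a chain with card C elements is card C - 1.\<close>
definition ranked_poset :: "nat set \<Rightarrow> (nat \<Rightarrow> nat \<Rightarrow> bool) \<Rightarrow> nat \<Rightarrow> bool" where
  "ranked_poset V le z0 \<longleftrightarrow> finite V \<and> is_poset V le \<and> {m. is_minimal V le m} = {z0} \<and>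
     (\<forall>x\<in>V. \<exists>n. \<forall>C. maximal_chain_in le (interval V le z0 x) C \<longrightarrow> card C = Suc n)"

definition rk :: "nat set \<Rightarrow> (nat \<Rightarrow> nat \<Rightarrow> bool) \<Rightarrow> nat \<Rightarrow> nat \<Rightarrow> nat" where
  "rk V le z0 x = (THE n. \<forall>C. maximal_chain_in le (interval V le z0 x) C \<longrightarrow> card C = Suc n)"

definition covers :: "nat set \<Rightarrow> (nat \<Rightarrow> nat \<Rightarrow> bool) \<Rightarrow> nat \<Rightarrow> nat \<Rightarrow> nat \<Rightarrow> bool" where
  "covers V le z0 x y \<longleftrightarrow> x \<in> V \<and> y \<in> V \<and> lt le y x \<and> rk V le z0 x = rk V le z0 y + 1"

definition Edges :: "nat set \<Rightarrow> (nat \<Rightarrow> nat \<Rightarrow> bool) \<Rightarrow> nat \<Rightarrow> edge set" where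
  "Edges V le z0 = {(x, y). covers V le z0 x y}"

definition wt :: "nat set \<Rightarrow> (nat \<Rightarrow> nat \<Rightarrow> bool) \<Rightarrow> nat \<Rightarrow> word \<Rightarrow> nat" where
  "wt V le z0 w = sum_list (map (\<lambda>e. rk V le z0 (fst e)) w)"

definition is_path :: "nat set \<Rightarrow> (nat \<Rightarrow> nat \<Rightarrow> bool) \<Rightarrow> nat \<Rightarrow> nat \<Rightarrow> nat \<Rightarrow> nat list \<Rightarrow> bool" where
  "is_path V le z0 b a cs \<longleftrightarrow> cs \<noteq> [] \<and> hd cs = b \<and> last cs = a \<and>
     (\<forall>i. Suc i < length cs \<longrightarrow> covers V le z0 (cs ! i) (cs ! Suc i))"

definition path_edges :: "nat list \<Rightarrow> edge list" where
  "path_edges cs = map (\<lambda>i. (cs ! i, cs ! Suc i)) [0..<length cs - 1]"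

definition fsc :: "'k::field \<Rightarrow> ('w \<Rightarrow> 'k) \<Rightarrow> ('w \<Rightarrow> 'k)" where
  "fsc c f = (\<lambda>x. c * f x)"

abbreviation fspan :: "('w \<Rightarrow> 'k::field) set \<Rightarrow> ('w \<Rightarrow> 'k) set" where
  "fspan \<equiv> module.span fsc"

abbreviation fdim :: "('w \<Rightarrow> 'k::field) set \<Rightarrow> nat" where
  "fdim \<equiv> vector_space.dim fsc"

definition delta :: "'w \<Rightarrow> 'w \<Rightarrow> 'k::field" where
  "delta w = (\<lambda>x. if x = w then 1 else 0)"

section \<open>The free algebra T(W) (elements: functions word => k of finite support) and ideals\<close>

text \<open>e(pi,j) for an edge list es: coefficient of s^(n-j) in (s - e1)...(s - en),
  i.e. (-1)^j times the sum of all ordered subproducts of length j.\<close>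
definition esym :: "edge list \<Rightarrow> nat \<Rightarrow> word \<Rightarrow> 'k::field" where
  "esym es j = (\<lambda>w. (-1) ^ j * of_nat (card {S. S \<subseteq> {..<length es} \<and> card S = j \<and>
                  map (\<lambda>i. es ! i) (sorted_list_of_set S) = w}))"

definition gens :: "nat set \<Rightarrow> (nat \<Rightarrow> nat \<Rightarrow> bool) \<Rightarrow> nat \<Rightarrow> (word \<Rightarrow> 'k::field) set" where
  "gens V le z0 = {esym (path_edges p) j - esym (path_edges q) j | a b p q j.
      a \<in> V \<and> b \<in> V \<and> lt le a b \<and> is_path V le z0 b a p \<and> is_path V le z0 b a q \<and>
      j \<le> length (path_edges p)}"

text \<open>The product u * g * v in T(W) of words u, v with an element g.\<close>
definition sandwich :: "word \<Rightarrow> (word \<Rightarrow> 'k::field) \<Rightarrow> word \<Rightarrow> word \<Rightarrow> 'k" where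
  "sandwich u g v = (\<lambda>x. if length u + length v \<le> length x \<and> take (length u) x = u \<and>
       drop (length x - length v) x = v
     then g (take (length x - length u - length v) (drop (length u) x)) else 0)"

definition idealI :: "nat set \<Rightarrow> (nat \<Rightarrow> nat \<Rightarrow> bool) \<Rightarrow> nat \<Rightarrow> (word \<Rightarrow> 'k::field) set" where
  "idealI V le z0 = fspan {sandwich u g v | u g v.
      set u \<subseteq> Edges V le z0 \<and> set v \<subseteq> Edges V le z0 \<and> g \<in> gens V le z0}"

definition FTlt :: "nat set \<Rightarrow> (nat \<Rightarrow> nat \<Rightarrow> bool) \<Rightarrow> nat \<Rightarrow> nat \<Rightarrow> (word \<Rightarrow> 'k::field) set" where
  "FTlt V le z0 n = fspan {delta w | w. set w \<subseteq> Edges V le z0 \<and> wt V le z0 w < n}"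

definition WtH :: "nat set \<Rightarrow> (nat \<Rightarrow> nat \<Rightarrow> bool) \<Rightarrow> nat \<Rightarrow> nat \<Rightarrow> (word \<Rightarrow> 'k::field) set" where
  "WtH V le z0 n = fspan {delta w | w. set w \<subseteq> Edges V le z0 \<and> wt V le z0 w = n}"

text \<open>A'_Gamma = gr A_Gamma = T(W) / in(I), where in(I) is spanned by the top-weight
  components of elements of I (the kernel of gr T(W) = T(W) -> gr A_Gamma).\<close>
definition leadI :: "nat set \<Rightarrow> (nat \<Rightarrow> nat \<Rightarrow> bool) \<Rightarrow> nat \<Rightarrow> (word \<Rightarrow> 'k::field) set" where
  "leadI V le z0 = fspan {h. \<exists>n. h \<in> WtH V le z0 n \<and>
                               h \<in> fspan (idealI V le z0 \<union> FTlt V le z0 n)}"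

section \<open>Normalized bar complex of A = T(E)/J, computing Tor^A(k,k)\<close>

definition Tpos :: "edge set \<Rightarrow> (word \<Rightarrow> 'k::field) set" where
  "Tpos E = fspan {delta w | w. w \<noteq> [] \<and> set w \<subseteq> E}"

definition Bas :: "edge set \<Rightarrow> nat \<Rightarrow> nat \<Rightarrow> tuple set" where
  "Bas E i j = {t. length t = i \<and> (\<forall>w\<in>set t. w \<noteq> [] \<and> set w \<subseteq> E) \<and> sum_list (map length t) = j}"

definition Deg :: "nat \<Rightarrow> (tuple \<Rightarrow> 'k::field) set" where
  "Deg j = {f. \<forall>t. f t \<noteq> 0 \<longrightarrow> sum_list (map length t) = j}"

text \<open>Bar chains (T_+)^{tensor i} in internal degree j.\<close>
definition BarV :: "edge set \<Rightarrow> nat \<Rightarrow> nat \<Rightarrow> (tuple \<Rightarrow> 'k::field) set" where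
  "BarV E i j = fspan (delta ` Bas E i j)"

definition tens :: "(word \<Rightarrow> 'k::field) list \<Rightarrow> tuple \<Rightarrow> 'k" where
  "tens fs = (\<lambda>t. if length t = length fs then (\<Prod>k<length t. (fs ! k) (t ! k)) else 0)"

text \<open>Kernel of (T_+)^{tensor i} -> (A_+)^{tensor i}, in internal degree j.\<close>
definition BarK :: "edge set \<Rightarrow> (word \<Rightarrow> 'k::field) set \<Rightarrow> nat \<Rightarrow> nat \<Rightarrow> (tuple \<Rightarrow> 'k) set" where
  "BarK E J i j = fspan {tens fs | fs. length fs = i \<and> (\<forall>f\<in>set fs. f \<in> Tpos E) \<and>
                                        (\<exists>f\<in>set fs. f \<in> J)} \<inter> Deg j"

definition merge :: "tuple \<Rightarrow> nat \<Rightarrow> tuple" where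
  "merge t k = take (k - 1) t @ [t ! (k - 1) @ t ! k] @ drop (Suc k) t"

text \<open>Bar differential d[a1|...|ai] = sum_{k=1}^{i-1} (-1)^k [a1|...|a_k a_{k+1}|...|ai]
  (extended linearly to finitely supported functions).\<close>
definition bar_d :: "(tuple \<Rightarrow> 'k::field) \<Rightarrow> tuple \<Rightarrow> 'k" where
  "bar_d f = (\<lambda>s. \<Sum>t\<in>{t. f t \<noteq> 0}. f t *
                   (\<Sum>k\<in>{1..<length t}. if merge t k = s then (-1) ^ k else 0))"

definition TorZ :: "edge set \<Rightarrow> (word \<Rightarrow> 'k::field) set \<Rightarrow> nat \<Rightarrow> nat \<Rightarrow> (tuple \<Rightarrow> 'k) set" where
  "TorZ E J i j = {x \<in> BarV E i j. bar_d x \<in> BarK E J (i - 1) j}"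

definition TorB :: "edge set \<Rightarrow> (word \<Rightarrow> 'k::field) set \<Rightarrow> nat \<Rightarrow> nat \<Rightarrow> (tuple \<Rightarrow> 'k) set" where
  "TorB E J i j = fspan (bar_d ` BarV E (Suc i) j \<union> BarK E J i j)"

definition tor_dim :: "edge set \<Rightarrow> (word \<Rightarrow> 'k::field) set \<Rightarrow> nat \<Rightarrow> nat \<Rightarrow> nat" where
  "tor_dim E J i j = fdim (TorZ E J i j) - fdim (TorB E J i j)"

definition pairing :: "edge set \<Rightarrow> nat \<Rightarrow> nat \<Rightarrow> (tuple \<Rightarrow> 'k::field) \<Rightarrow> (tuple \<Rightarrow> 'k) \<Rightarrow> 'k" where
  "pairing E i j g f = (\<Sum>t\<in>Bas E i j. g t * f t)"

text \<open>Hom_k(B_{i,j}, k): functionals on bar chains vanishing on the kernel.\<close>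
definition HomC :: "edge set \<Rightarrow> (word \<Rightarrow> 'k::field) set \<Rightarrow> nat \<Rightarrow> nat \<Rightarrow> (tuple \<Rightarrow> 'k) set" where
  "HomC E J i j = {g. (\<forall>t. t \<notin> Bas E i j \<longrightarrow> g t = 0) \<and>
                      (\<forall>k\<in>BarK E J i j. pairing E i j g k = 0)}"

definition cobd :: "edge set \<Rightarrow> nat \<Rightarrow> nat \<Rightarrow> (tuple \<Rightarrow> 'k::field) \<Rightarrow> tuple \<Rightarrow> 'k" where
  "cobd E i j g = (\<lambda>t. if t \<in> Bas E (Suc i) j then pairing E i j g (bar_d (delta t)) else 0)"

definition ExtZ :: "edge set \<Rightarrow> (word \<Rightarrow> 'k::field) set \<Rightarrow> nat \<Rightarrow> nat \<Rightarrow> (tuple \<Rightarrow> 'k) set" where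
  "ExtZ E J i j = {g \<in> HomC E J i j. cobd E i j g = 0}"

definition ExtB :: "edge set \<Rightarrow> (word \<Rightarrow> 'k::field) set \<Rightarrow> nat \<Rightarrow> nat \<Rightarrow> (tuple \<Rightarrow> 'k) set" where
  "ExtB E J i j = {cobd E i' j g | i' g. Suc i' = i \<and> g \<in> HomC E J i' j}"

definition ext_dim :: "edge set \<Rightarrow> (word \<Rightarrow> 'k::field) set \<Rightarrow> nat \<Rightarrow> nat \<Rightarrow> nat" where
  "ext_dim E J i j = fdim (ExtZ E J i j) - fdim (ExtB E J i j)"

definition twt :: "nat set \<Rightarrow> (nat \<Rightarrow> nat \<Rightarrow> bool) \<Rightarrow> nat \<Rightarrow> tuple \<Rightarrow> nat" where
  "twt V le z0 t = sum_list (map (wt V le z0) t)"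

definition FV :: "nat set \<Rightarrow> (nat \<Rightarrow> nat \<Rightarrow> bool) \<Rightarrow> nat \<Rightarrow> nat \<Rightarrow> nat \<Rightarrow> nat \<Rightarrow> (tuple \<Rightarrow> 'k::field) set" where
  "FV V le z0 n i j = fspan (delta ` {t \<in> Bas (Edges V le z0) i j. twt V le z0 t \<le> n})"

definition FVlt :: "nat set \<Rightarrow> (nat \<Rightarrow> nat \<Rightarrow> bool) \<Rightarrow> nat \<Rightarrow> nat \<Rightarrow> nat \<Rightarrow> nat \<Rightarrow> (tuple \<Rightarrow> 'k::field) set" where
  "FVlt V le z0 n i j = fspan (delta ` {t \<in> Bas (Edges V le z0) i j. twt V le z0 t < n})"

text \<open>dim of gr_n Tor^{A_Gamma}_{i,j}: F^n Tor = image of H(F^n B) in H(B).\<close>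
definition gr_tor_piece :: "nat set \<Rightarrow> (nat \<Rightarrow> nat \<Rightarrow> bool) \<Rightarrow> nat \<Rightarrow> 'k::field itself \<Rightarrow> nat \<Rightarrow> nat \<Rightarrow> nat \<Rightarrow> nat" where
  "gr_tor_piece V le z0 (_ :: 'k itself) i j n =
     (let E = Edges V le z0; J = (idealI V le z0 :: (word \<Rightarrow> 'k) set);
          Z = TorZ E J i j; B = TorB E J i j; K = BarK E J i j in
      fdim (fspan ((Z \<inter> fspan (FV V le z0 n i j \<union> K)) \<union> B))
      - fdim (fspan ((Z \<inter> fspan (FVlt V le z0 n i j \<union> K)) \<union> B)))"

definition gr_tor_dim :: "nat set \<Rightarrow> (nat \<Rightarrow> nat \<Rightarrow> bool) \<Rightarrow> nat \<Rightarrow> 'k::field itself \<Rightarrow> nat \<Rightarrow> nat \<Rightarrow> nat" where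
  "gr_tor_dim V le z0 K i j = Sum_any (gr_tor_piece V le z0 K i j)"

text \<open>Dual filtration on the Hom complex: F^p Hom = functionals vanishing on F^{<p} B;
  F^p Ext = image of H(F^p Hom) in Ext, gr^p = F^p / F^{p+1}.\<close>
definition FHom :: "nat set \<Rightarrow> (nat \<Rightarrow> nat \<Rightarrow> bool) \<Rightarrow> nat \<Rightarrow> (word \<Rightarrow> 'k::field) set \<Rightarrow> nat \<Rightarrow> nat \<Rightarrow> nat \<Rightarrow> (tuple \<Rightarrow> 'k) set" where
  "FHom V le z0 J p i j = {g \<in> HomC (Edges V le z0) J i j.
      \<forall>f\<in>FVlt V le z0 p i j. pairing (Edges V le z0) i j g f = 0}"

definition gr_ext_piece :: "nat set \<Rightarrow> (nat \<Rightarrow> nat \<Rightarrow> bool) \<Rightarrow> nat \<Rightarrow> 'k::field itself \<Rightarrow> nat \<Rightarrow> nat \<Rightarrow> nat \<Rightarrow> nat" where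
  "gr_ext_piece V le z0 (_ :: 'k itself) i j p =
     (let E = Edges V le z0; J = (idealI V le z0 :: (word \<Rightarrow> 'k) set);
          Z = ExtZ E J i j; B = ExtB E J i j in
      fdim (fspan ((Z \<inter> FHom V le z0 J p i j) \<union> B))
      - fdim (fspan ((Z \<inter> FHom V le z0 J (Suc p) i j) \<union> B)))"

definition gr_ext_dim :: "nat set \<Rightarrow> (nat \<Rightarrow> nat \<Rightarrow> bool) \<Rightarrow> nat \<Rightarrow> 'k::field itself \<Rightarrow> nat \<Rightarrow> nat \<Rightarrow> nat" where
  "gr_ext_dim V le z0 K i j = Sum_any (gr_ext_piece V le z0 K i j)"

definition tor_dim_A' :: "nat set \<Rightarrow> (nat \<Rightarrow> nat \<Rightarrow> bool) \<Rightarrow> nat \<Rightarrow> 'k::field itself \<Rightarrow> nat \<Rightarrow> nat \<Rightarrow> nat" where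
  "tor_dim_A' V le z0 (_ :: 'k itself) i j =
     tor_dim (Edges V le z0) (leadI V le z0 :: (word \<Rightarrow> 'k) set) i j"

definition ext_dim_A' :: "nat set \<Rightarrow> (nat \<Rightarrow> nat \<Rightarrow> bool) \<Rightarrow> nat \<Rightarrow> 'k::field itself \<Rightarrow> nat \<Rightarrow> nat \<Rightarrow> nat" where
  "ext_dim_A' V le z0 (_ :: 'k itself) i j =
     ext_dim (Edges V le z0) (leadI V le z0 :: (word \<Rightarrow> 'k) set) i j"

text \<open>Bigraded vector spaces with finite-dimensional components are isomorphic iff
  their dimensions agree in every bidegree.\<close>
definition bigraded_iso :: "(nat \<Rightarrow> nat \<Rightarrow> nat) \<Rightarrow> (nat \<Rightarrow> nat \<Rightarrow> nat) \<Rightarrow> bool" where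
  "bigraded_iso d1 d2 \<longleftrightarrow> (\<forall>i j. d1 i j = d2 i j)"

end

theory Submission
  imports Defs
begin

text \<open>The poset has a top vertex 7 covering 5 and 6 (rank 3), each of which covers both 3 and 4 (rank 2),
  where 3 covers only 1 and 4 covers only 2 (rank 1), above the minimum 0. The intervals from 0 to 5
  and from 0 to 6 are not uniform, so each of 5 and 6 contributes a cubic relation to the associated
  graded algebra, and the leading terms \<open>7(5 - 6)\<close>, \<open>5(3 - 4)\<close>, \<open>6(3 - 4)\<close> of the quadratic relations
  have the overlap \<open>7(5 - 6)(3 - 4)\<close>, a nonzero class of bidegree (3, 3). In the splitting algebra this
  overlap does not lift: resolving it produces the difference of the two cubic relations. With \<open>V\<close> the
  degree one part and \<open>R\<close> the quadratic relations, \<open>(R \<otimes> V) \<inter> (V \<otimes> R) = 0\<close>, so both Tor and Ext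
  vanish in bidegree (3, 3).\<close>

section \<open>Linear algebra of functions\<close>

text \<open>Four nonempty words have total length at least 4, so in bidegree (3, 3) no chains map
  in, and Tor is the space of cycles modulo the kernel of the map from the bar complex of the free
  algebra to that of the quotient. Hence only the parts of degree one and two of the two ideals
  enter, and each in the easier direction: for the splitting algebra an upper bound on the
  relations, for the associated graded algebra a few explicit leading terms in degree two and an
  upper bound in degree one. The obstacle is that the edges satisfy linear relations, so chains are
  written in a redundant alphabet; coordinates indexed by the nonzero vertices remove the
  redundancy. The coefficients in the relations are 0, 1 and -1, so the argument is the same over
  every field. For the splitting algebra Ext follows from Tor by duality, and all filtration
  quotients vanish with them. For the associated graded algebra a cycle and a cocycle with pairing 1
  settle Tor and Ext at once.\<close>

interpretation fs: vector_space "fsc :: 'k::field \<Rightarrow> ('w \<Rightarrow> 'k) \<Rightarrow> 'w \<Rightarrow> 'k"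
  by unfold_locales (auto simp: fsc_def fun_eq_iff algebra_simps)

interpretation fs_pair: vector_space_pair
  "fsc :: 'k::field \<Rightarrow> ('v \<Rightarrow> 'k) \<Rightarrow> 'v \<Rightarrow> 'k" "fsc :: 'k::field \<Rightarrow> ('w \<Rightarrow> 'k) \<Rightarrow> 'w \<Rightarrow> 'k"
  by unfold_locales

lemma fsc_apply [simp]: "fsc c f x = c * f x"
  by (simp add: fsc_def)

lemma delta_apply: "delta w x = (if x = w then 1 else 0)"
  by (simp add: delta_def)

lemma sum_fun_apply: "(\<Sum>i\<in>A. f i) x = (\<Sum>i\<in>A. f i x)"
  by (induction A rule: infinite_finite_induct) auto

lemma linear_fscI:
  assumes "\<And>x y. f (x + y) = f x + f y" and "\<And>c x. f (fsc c x) = fsc c (f x)"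
  shows "Vector_Spaces.linear fsc fsc f"
  using assms by (intro Vector_Spaces.linear.intro module_hom.intro module_hom_axioms.intro) unfold_locales

definition functional :: "(('w \<Rightarrow> 'k::field) \<Rightarrow> 'k) \<Rightarrow> bool" where
  "functional h \<longleftrightarrow> (\<forall>x y. h (x + y) = h x + h y) \<and> (\<forall>c x. h (fsc c x) = c * h x)"

lemma functionalI:
  assumes "\<And>x y. h (x + y) = h x + h y" and "\<And>c x. h (fsc c x) = c * h x"
  shows "functional h"
  using assms by (simp add: functional_def)

lemma functional_add: "functional h \<Longrightarrow> h (x + y) = h x + h y"
  by (simp add: functional_def)

lemma functional_scale: "functional h \<Longrightarrow> h (fsc c x) = c * h x"
  by (simp add: functional_def)

lemma functional_zero: "functional h \<Longrightarrow> h 0 = 0"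
  by (metis add_0 add_cancel_right_right functional_add)

lemma functional_diff: "functional h \<Longrightarrow> h (x - y) = h x - h y"
  by (metis diff_add_cancel functional_add add_diff_cancel)

lemma functional_sum: "functional h \<Longrightarrow> h (\<Sum>i\<in>A. f i) = (\<Sum>i\<in>A. h (f i))"
  by (induction A rule: infinite_finite_induct) (simp_all add: functional_zero functional_add)

lemma subspace_functional_kernel: "functional h \<Longrightarrow> fs.subspace {x. h x = 0}"
  by (auto simp: fs.subspace_def functional_zero functional_add functional_scale)

lemma sum_fsc_delta:
  assumes "finite A"
  shows "(\<Sum>x\<in>A. fsc (c x) (delta x)) = (\<lambda>y. if y \<in> A then c y else (0::'k::field))"
proof
  fix y
  have "(\<Sum>x\<in>A. fsc (c x) (delta x)) y = (\<Sum>x\<in>A. if x = y then c x else 0)"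
    unfolding sum_fun_apply by (rule sum.cong) (simp_all add: delta_apply)
  then show "(\<Sum>x\<in>A. fsc (c x) (delta x)) y = (if y \<in> A then c y else 0)"
    using assms by simp
qed

lemma functional_expand:
  assumes "functional h" "finite A" "\<And>x. x \<notin> A \<Longrightarrow> f x = 0"
  shows "h f = (\<Sum>x\<in>A. h (delta x) * f x)"
proof -
  have "f = (\<Sum>x\<in>A. fsc (f x) (delta x))"
    using assms(2,3) by (subst sum_fsc_delta) auto
  then have "h f = h (\<Sum>x\<in>A. fsc (f x) (delta x))" by (rule arg_cong)
  then show ?thesis using assms(1) by (simp add: functional_sum functional_scale mult.commute)
qed

text \<open>A functional that vanishes on the preimage of \<open>S\<close> under \<open>D\<close>
  descends to the image of \<open>D\<close> modulo \<open>S\<close> and extends from there to the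
  whole space. For the bar differential this turns a cocycle that kills all cycles into a
  coboundary.\<close>

lemma factor_functional:
  fixes D :: "('v \<Rightarrow> 'k::field) \<Rightarrow> 'w \<Rightarrow> 'k"
  assumes D: "Vector_Spaces.linear fsc fsc D" and g: "functional g"
    and S: "fs.subspace S" and ker: "\<And>x. D x \<in> S \<Longrightarrow> g x = 0"
  obtains h where "functional h" "\<And>y. y \<in> S \<Longrightarrow> h y = 0" "\<And>x. h (D x) = g x"
proof -
  interpret D: Vector_Spaces.linear fsc fsc D by fact
  have "Vector_Spaces.linear fsc fsc (\<lambda>x :: ('w \<Rightarrow> 'k). x)" by (rule linear_fscI) auto
  from fs_pair.linear_exists_left_inverse_on[OF this S]
  obtain \<pi> where \<pi>: "\<And>v. \<pi> v \<in> S" "Vector_Spaces.linear fsc fsc \<pi>" "\<And>v. v \<in> S \<Longrightarrow> \<pi> v = v"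
    by (auto simp: inj_on_def image_subset_iff)
  interpret \<pi>: Vector_Spaces.linear fsc fsc \<pi> by fact
  \<comment> \<open>\<open>p\<close> is a projection with kernel \<open>S\<close>, a model of the
    quotient by \<open>S\<close>. Below, \<open>r\<close> chooses preimages under \<open>p\<close>
    composed with \<open>D\<close>, and \<open>ker\<close> makes the value of \<open>g\<close>
    independent of the choice.\<close>
  define p where "p x = x - \<pi> x" for x
  have lq: "Vector_Spaces.linear fsc fsc (\<lambda>x. p (D x))"
    by (rule linear_fscI) (auto simp: p_def D.add \<pi>.add D.scale \<pi>.scale fun_eq_iff algebra_simps)
  obtain r where r: "Vector_Spaces.linear fsc fsc r" "\<And>x. p (D (r (p (D x)))) = p (D x)"
    using fs_pair.linear_exists_right_inverse_on[OF lq fs.subspace_UNIV] by auto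
  interpret r: Vector_Spaces.linear fsc fsc r by fact
  show thesis
  proof
    show "functional (\<lambda>y. g (r (p y)))"
    proof (rule functionalI)
      fix x y :: "'w \<Rightarrow> 'k" and c :: 'k
      have "p (x + y) = p x + p y" "p (fsc c x) = fsc c (p x)"
        by (auto simp: p_def \<pi>.add \<pi>.scale fun_eq_iff algebra_simps)
      then show "g (r (p (x + y))) = g (r (p x)) + g (r (p y))"
        "g (r (p (fsc c x))) = c * g (r (p x))"
        by (simp_all add: r.add r.scale functional_add[OF g] functional_scale[OF g])
    qed
    show "g (r (p y)) = 0" if "y \<in> S" for y
      using that \<pi>(3) by (simp add: p_def r.zero functional_zero[OF g])
    fix x
    have "p (D (r (p (D x)) - x)) = 0"
      using r(2)[of x] by (simp add: p_def D.diff \<pi>.diff algebra_simps)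
    then have "D (r (p (D x)) - x) = \<pi> (D (r (p (D x)) - x))" by (simp add: p_def)
    with \<pi>(1) have "D (r (p (D x)) - x) \<in> S" by metis
    then have "g (r (p (D x)) - x) = 0" by (rule ker)
    then show "g (r (p (D x))) = g x" by (simp add: functional_diff[OF g])
  qed
qed

text \<open>The finite set \<open>W\<close> keeps \<open>fdim\<close> meaningful. The strict
  inequality is what makes the truncated subtractions in \<open>tor_dim\<close> and
  \<open>ext_dim\<close> positive.\<close>

lemma fdim_strict_mono:
  assumes "S \<subseteq> T" "x \<in> T" "x \<notin> fspan S" "T \<subseteq> fspan W" "finite W"
  shows "fdim S < fdim T"
proof -
  obtain B where B: "B \<subseteq> S" "fs.independent B" "S \<subseteq> fspan B" "card B = fdim S"
    by (rule fs.basis_exists)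
  have spanB: "fspan B \<subseteq> fspan S" using B(1) by (rule fs.span_mono)
  have "fs.independent (insert x B)"
    using B(2) assms(3) spanB fs.independent_insertI[of x B] by blast
  moreover have "insert x B \<subseteq> T" using B(1) assms(1,2) by auto
  ultimately obtain C where C: "insert x B \<subseteq> C" "C \<subseteq> T" "fs.independent C" "T \<subseteq> fspan C"
    using fs.maximal_independent_subset_extend by metis
  have "finite C" using fs.independent_span_bound[OF assms(5) C(3)] C(2) assms(4) by blast
  moreover have "x \<notin> B" using assms(3) spanB fs.span_base by blast
  ultimately have "card B < card C" using C(1) by (intro psubset_card_mono) auto
  then show ?thesis using fs.basis_card_eq_dim[OF C(2,4,3)] B(4) by simp
qed

lemma subspace_support: "fs.subspace {f. \<forall>x. f x \<noteq> (0::'k::field) \<longrightarrow> P x}"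
proof (rule fs.subspaceI)
  fix f g :: "'a \<Rightarrow> 'k" assume "f \<in> {f. \<forall>x. f x \<noteq> 0 \<longrightarrow> P x}" "g \<in> {f. \<forall>x. f x \<noteq> 0 \<longrightarrow> P x}"
  then show "f + g \<in> {f. \<forall>x. f x \<noteq> 0 \<longrightarrow> P x}" by (simp, metis add_0)
qed auto

lemma span_delta_eq:
  assumes "finite A"
  shows "fspan (delta ` A) = {f. \<forall>x. x \<notin> A \<longrightarrow> f x = (0::'k::field)}" (is "?L = ?R")
proof
  have "fs.subspace ?R" by (auto simp: fs.subspace_def)
  then show "?L \<subseteq> ?R" by (intro fs.span_minimal) (auto simp: delta_apply)
  show "?R \<subseteq> ?L"
  proof
    fix f :: "'a \<Rightarrow> 'k" assume f: "f \<in> ?R"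
    have "f = (\<Sum>x\<in>A. fsc (f x) (delta x))"
      using f assms by (subst sum_fsc_delta) auto
    moreover have "(\<Sum>x\<in>A. fsc (f x) (delta x)) \<in> ?L"
      by (intro fs.span_sum fs.span_scale fs.span_base) auto
    ultimately show "f \<in> ?L" by simp
  qed
qed

section \<open>Bar complexes in a fixed bidegree\<close>

lemma finite_Bas:
  assumes "finite E" shows "finite (Bas E i j)"
proof -
  let ?W = "{w. set w \<subseteq> E \<and> length w \<le> j}"
  have "finite ?W" using assms by (rule finite_lists_length_le)
  then have "finite {t. set t \<subseteq> ?W \<and> length t = i}" by (rule finite_lists_length_eq)
  moreover have "Bas E i j \<subseteq> {t. set t \<subseteq> ?W \<and> length t = i}"
    by (auto simp: Bas_def member_le_sum_list)
  ultimately show ?thesis by (rule finite_subset[rotated])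
qed

lemma BarV_eq:
  "finite E \<Longrightarrow> BarV E i j = {f. \<forall>x. x \<notin> Bas E i j \<longrightarrow> f x = (0::'k::field)}"
  unfolding BarV_def by (rule span_delta_eq[OF finite_Bas])

lemma merge_Bas:
  assumes "t \<in> Bas E (Suc i) j" "k \<in> {1..<length t}"
  shows "merge t k \<in> Bas E i j"
proof -
  from assms have k: "0 < k" "k < length t" and t: "length t = Suc i" by (auto simp: Bas_def)
  then obtain l where l: "k = Suc l" by (cases k) auto
  have t_eq: "t = take l t @ [t ! l, t ! Suc l] @ drop (Suc (Suc l)) t"
    using k l by (simp add: Cons_nth_drop_Suc)
  obtain xs a b ys where t': "t = xs @ [a, b] @ ys" "length xs = l"
    using t_eq k l by (metis length_take less_imp_le_nat min_absorb2 Suc_lessD)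
  have "merge t k = xs @ [a @ b] @ ys"
    using t'(2) l by (simp add: merge_def t'(1) nth_append)
  with assms(1) t' show ?thesis by (auto simp: Bas_def)
qed

lemma bar_d_eq:
  assumes "finite A" "\<And>x. x \<notin> A \<Longrightarrow> f x = 0"
  shows "bar_d f s = (\<Sum>t\<in>A. f t * (\<Sum>k\<in>{1..<length t}. if merge t k = s then (-1) ^ k else 0))"
  unfolding bar_d_def by (rule sum.mono_neutral_left) (use assms in auto)

lemma bar_d_delta:
  "bar_d (delta t) s = (\<Sum>k\<in>{1..<length t}. if merge t k = s then (-1) ^ k else 0)"
  by (subst bar_d_eq[of "{t}"]) (auto simp: delta_apply)

lemma bar_d_expand:
  assumes "finite A" "\<And>x. x \<notin> A \<Longrightarrow> f x = 0"
  shows "bar_d f = (\<Sum>t\<in>A. fsc (f t) (bar_d (delta t)))"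
  by (rule ext) (simp add: bar_d_eq[OF assms] bar_d_delta sum_fun_apply)

lemma bar_d_delta_BarV:
  assumes "finite E" "t \<in> Bas E (Suc i) j"
  shows "bar_d (delta t) \<in> BarV E i j"
  using merge_Bas[OF assms(2)] by (auto simp: BarV_eq[OF assms(1)] bar_d_delta intro!: sum.neutral)

lemma subspace_BarK: "fs.subspace (BarK E J i j)"
  unfolding BarK_def by (intro fs.subspace_inter fs.subspace_span) (simp add: Deg_def subspace_support)

text \<open>A nonzero value of a pure tensor needs a nonzero value of every factor, so all its words
  are nonempty words in \<open>E\<close>; \<open>Deg j\<close> then fixes the total length.\<close>

lemma BarK_subset_BarV:
  assumes "finite E" shows "BarK E J i j \<subseteq> (BarV E i j :: (tuple \<Rightarrow> 'k::field) set)"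
proof
  let ?P = "{f :: tuple \<Rightarrow> 'k. \<forall>t. f t \<noteq> 0 \<longrightarrow> length t = i \<and> (\<forall>w\<in>set t. w \<noteq> [] \<and> set w \<subseteq> E)}"
  fix f :: "tuple \<Rightarrow> 'k" assume f: "f \<in> BarK E J i j"
  have Tpos: "w \<noteq> [] \<and> set w \<subseteq> E" if "g \<in> Tpos E" "g w \<noteq> 0" for g :: "word \<Rightarrow> 'k" and w
  proof -
    have "g \<in> {g. \<forall>w. g w \<noteq> 0 \<longrightarrow> w \<noteq> [] \<and> set w \<subseteq> E}"
    proof (rule subsetD[OF fs.span_minimal that(1)[unfolded Tpos_def]])
      show "fs.subspace {g :: word \<Rightarrow> 'k. \<forall>w. g w \<noteq> 0 \<longrightarrow> w \<noteq> [] \<and> set w \<subseteq> E}"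
        by (rule subspace_support)
    qed (auto simp: delta_apply split: if_splits)
    with that(2) show ?thesis by blast
  qed
  have "f \<in> ?P"
  proof (rule subsetD[OF fs.span_minimal])
    show "f \<in> fspan {tens fs | fs. length fs = i \<and> (\<forall>f\<in>set fs. f \<in> Tpos E) \<and> (\<exists>f\<in>set fs. f \<in> J)}"
      using f by (simp add: BarK_def)
    show "fs.subspace ?P" by (rule subspace_support)
    show "{tens fs | fs. length fs = i \<and> (\<forall>f\<in>set fs. f \<in> Tpos E) \<and> (\<exists>f\<in>set fs. f \<in> J)} \<subseteq> ?P"
    proof (intro subsetI CollectI allI impI)
      fix h t assume "h \<in> {tens fs | fs. length fs = i \<and> (\<forall>f\<in>set fs. f \<in> Tpos E) \<and> (\<exists>f\<in>set fs. f \<in> J)}"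
        and h: "h t \<noteq> 0"
      then obtain fs where fs: "length fs = i" "\<forall>f\<in>set fs. f \<in> Tpos E" and "h = tens fs" by blast
      with h have t: "tens fs t \<noteq> 0" by simp
      then have len: "length t = length fs" by (auto simp: tens_def split: if_splits)
      with t have nz: "(fs ! k) (t ! k) \<noteq> 0" if "k < length t" for k
        using that by (auto simp: tens_def)
      have "w \<noteq> [] \<and> set w \<subseteq> E" if "w \<in> set t" for w
        using that nz fs(2) len Tpos by (metis in_set_conv_nth)
      then show "length t = i \<and> (\<forall>w\<in>set t. w \<noteq> [] \<and> set w \<subseteq> E)"
        using len fs(1) by simp
    qed
  qed
  with f show "f \<in> BarV E i j"
    by (fastforce simp: BarV_eq[OF assms] BarK_def Deg_def Bas_def)
qed

lemma bar_d_BarV: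
  assumes "finite E" "f \<in> BarV E (Suc i) j"
  shows "bar_d f \<in> (BarV E i j :: (tuple \<Rightarrow> 'k::field) set)"
proof -
  have "bar_d f = (\<Sum>t\<in>Bas E (Suc i) j. fsc (f t) (bar_d (delta t)))"
    using assms by (intro bar_d_expand finite_Bas) (auto simp: BarV_eq)
  moreover have "\<dots> \<in> BarV E i j"
    using bar_d_delta_BarV[OF assms(1)] unfolding BarV_def
    by (intro fs.span_sum fs.span_scale)
  ultimately show ?thesis by simp
qed

section \<open>Pairing of chains with cochains\<close>

lemma functional_pairing: "functional (pairing E i j g)"
  by (rule functionalI) (simp_all add: pairing_def algebra_simps sum.distrib sum_distrib_left)

lemma pairing_sum_fsc:
  "pairing E i j g (\<Sum>t\<in>A. fsc (c t) (F t)) = (\<Sum>t\<in>A. c t * pairing E i j g (F t))"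
proof -
  show ?thesis by (simp add: functional_sum[OF functional_pairing] functional_scale[OF functional_pairing])
qed

lemma cobd_pairing:
  assumes "finite E" "f \<in> BarV E (Suc i) j"
  shows "pairing E (Suc i) j (cobd E i j g) f = pairing E i j g (bar_d f)"
proof -
  have f: "\<And>x. x \<notin> Bas E (Suc i) j \<Longrightarrow> f x = 0" using assms by (auto simp: BarV_eq)
  have "pairing E i j g (bar_d f) = (\<Sum>t\<in>Bas E (Suc i) j. f t * pairing E i j g (bar_d (delta t)))"
    by (subst bar_d_expand[OF finite_Bas[OF assms(1)] f]) (simp_all add: pairing_sum_fsc)
  then show ?thesis
    by (simp add: pairing_def[of E "Suc i"] cobd_def mult.commute)
qed

lemma pairing_TorB:
  assumes "finite E" "g \<in> ExtZ E J i j" "x \<in> TorB E J i j"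
  shows "pairing E i j g x = 0"
proof -
  have "TorB E J i j \<subseteq> {x. pairing E i j g x = 0}"
    unfolding TorB_def
  proof (rule fs.span_minimal)
    show "fs.subspace {x. pairing E i j g x = 0}"
      by (rule subspace_functional_kernel[OF functional_pairing])
    have "pairing E i j g (bar_d y) = 0" if "y \<in> BarV E (Suc i) j" for y
      using cobd_pairing[OF assms(1) that, of g] assms(2) by (simp add: ExtZ_def pairing_def)
    then show "bar_d ` BarV E (Suc i) j \<union> BarK E J i j \<subseteq> {x. pairing E i j g x = 0}"
      using assms(2) by (auto simp: ExtZ_def HomC_def)
  qed
  with assms(3) show ?thesis by auto
qed

text \<open>Duality over a field: a cocycle annihilates \<open>TorB\<close>, hence all cycles, so it
  factors through the differential. The factor vanishes on \<open>BarK\<close> and is therefore a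
  cochain with the given coboundary.\<close>

lemma ExtZ_subset_ExtB:
  fixes J :: "(word \<Rightarrow> 'k::field) set"
  assumes E: "finite E" and Tor: "TorZ E J (Suc i) j \<subseteq> TorB E J (Suc i) j"
  shows "ExtZ E J (Suc i) j \<subseteq> ExtB E J (Suc i) j"
proof
  fix g assume g: "g \<in> ExtZ E J (Suc i) j"
  \<comment> \<open>\<open>bar_d\<close> sums over the support and is not additive on functions of
    infinite support. \<open>D\<close> agrees with it on chains and is linear on all functions, as
    \<open>factor_functional\<close> requires.\<close>
  define D where "D f = (\<Sum>t\<in>Bas E (Suc i) j. fsc (f t) (bar_d (delta t)))" for f :: "tuple \<Rightarrow> 'k"
  define r where "r f = (\<lambda>t. if t \<in> Bas E (Suc i) j then f t else 0)" for f :: "tuple \<Rightarrow> 'k"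
  have r: "r f \<in> BarV E (Suc i) j" for f by (simp add: r_def BarV_eq[OF E])
  have D: "D f = bar_d (r f)" for f
    unfolding D_def by (subst bar_d_expand[OF finite_Bas[OF E]]) (auto simp: r_def intro!: sum.cong)
  have pr: "pairing E (Suc i) j g (r f) = pairing E (Suc i) j g f" for f
    by (simp add: pairing_def r_def)
  have linD: "Vector_Spaces.linear fsc fsc D"
  proof (rule linear_fscI)
    show "D (x + y) = D x + D y" for x y
      by (simp add: D_def fs.scale_left_distrib sum.distrib)
    show "D (fsc c x) = fsc c (D x)" for c x
      by (simp add: D_def fs.scale_sum_right)
  qed
  have ker: "pairing E (Suc i) j g f = 0" if "D f \<in> BarK E J i j" for f
  proof -
    have "r f \<in> TorZ E J (Suc i) j" using that r[of f] by (simp add: TorZ_def D)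
    with Tor have "r f \<in> TorB E J (Suc i) j" by blast
    then have "pairing E (Suc i) j g (r f) = 0" by (rule pairing_TorB[OF E g])
    then show ?thesis by (simp add: pr)
  qed
  obtain h where h: "functional h" "\<And>y. y \<in> BarK E J i j \<Longrightarrow> h y = 0"
      "\<And>x. h (D x) = pairing E (Suc i) j g x"
    using factor_functional[OF linD functional_pairing subspace_BarK ker] by blast
  \<comment> \<open>Cochains must vanish off the basis; cutting \<open>h\<close> down to its values
    on basis tuples changes nothing on \<open>BarV\<close>.\<close>
  define h' where "h' = (\<lambda>t. if t \<in> Bas E i j then h (delta t) else 0)"
  have ph': "pairing E i j h' f = h f" if "f \<in> BarV E i j" for f
    using functional_expand[OF h(1) finite_Bas[OF E], of i j f] that
    by (simp add: pairing_def h'_def BarV_eq[OF E])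
  have "pairing E i j h' k = 0" if "k \<in> BarK E J i j" for k
    using ph'[OF subsetD[OF BarK_subset_BarV[OF E] that]] h(2)[OF that] by simp
  then have "h' \<in> HomC E J i j"
    by (simp add: HomC_def h'_def)
  moreover have "cobd E i j h' = g"
  proof
    fix t
    show "cobd E i j h' t = g t"
    proof (cases "t \<in> Bas E (Suc i) j")
      case True
      have "r (delta t) = delta t" using True by (auto simp: r_def delta_apply)
      then have "D (delta t) = bar_d (delta t)" by (simp add: D)
      with True h(3)[of "delta t"] ph'[OF bar_d_delta_BarV[OF E True]] show ?thesis
        by (simp add: cobd_def pairing_def delta_apply finite_Bas[OF E] if_distrib cong: if_cong)
    next
      case False
      then show ?thesis using g by (simp add: cobd_def ExtZ_def HomC_def)
    qed
  qed
  ultimately show "g \<in> ExtB E J (Suc i) j" by (auto simp: ExtB_def)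
qed

text \<open>If every cycle is a boundary, each filtration step together with the boundaries spans
  only the boundaries, so consecutive dimensions agree whatever the filtration is.\<close>

lemma gr_dims_zero:
  fixes V :: "nat set" and le z0
  defines "E \<equiv> Edges V le z0"
  assumes E: "finite E" and Tor: "TorZ E (idealI V le z0 :: (word \<Rightarrow> 'k::field) set) (Suc i) j
    \<subseteq> TorB E (idealI V le z0) (Suc i) j"
  shows "gr_tor_dim V le z0 TYPE('k) (Suc i) j = 0" "gr_ext_dim V le z0 TYPE('k) (Suc i) j = 0"
proof -
  have span: "fspan ((Z \<inter> X) \<union> B) = fspan B" if "Z \<subseteq> B" for Z X B :: "(tuple \<Rightarrow> 'k) set"
    using that by (metis Un_absorb1 inf.coboundedI1)
  have "gr_tor_piece V le z0 TYPE('k) (Suc i) j = (\<lambda>n. 0)"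
    using span[OF Tor] by (simp add: gr_tor_piece_def Let_def E_def fun_eq_iff del: fs.dim_span)
  then show "gr_tor_dim V le z0 TYPE('k) (Suc i) j = 0" by (simp add: gr_tor_dim_def)
  have "gr_ext_piece V le z0 TYPE('k) (Suc i) j = (\<lambda>n. 0)"
    using span[OF ExtZ_subset_ExtB[OF E Tor]] by (simp add: gr_ext_piece_def Let_def E_def fun_eq_iff del: fs.dim_span)
  then show "gr_ext_dim V le z0 TYPE('k) (Suc i) j = 0" by (simp add: gr_ext_dim_def)
qed

text \<open>With no chains one degree up, the boundaries lie in \<open>BarK\<close>, so a cochain
  \<open>g\<close> with nonzero value on the cycle \<open>x\<close> separates \<open>x\<close> from
  them; by adjointness \<open>x\<close> separates \<open>g\<close> from the coboundaries. Assumption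
  \<open>K\<close> says that the differential descends to the quotient, so that boundaries are
  cycles and the differences of dimensions mean what they should.\<close>

lemma tor_ext_dim_pos:
  fixes J :: "(word \<Rightarrow> 'k::field) set"
  assumes E: "finite E" and top: "Bas E (Suc (Suc i)) j = {}"
    and K: "bar_d ` BarK E J (Suc i) j \<subseteq> BarK E J i j"
    and g: "g \<in> HomC E J (Suc i) j" and x: "x \<in> TorZ E J (Suc i) j"
    and gx: "pairing E (Suc i) j g x \<noteq> 0"
  shows "tor_dim E J (Suc i) j > 0" "ext_dim E J (Suc i) j > 0"
proof -
  have Z: "TorZ E J (Suc i) j \<subseteq> fspan (delta ` Bas E (Suc i) j)"
    by (auto simp: TorZ_def BarV_def)
  have "bar_d (0 :: tuple \<Rightarrow> 'k) = 0" by (simp add: bar_d_def fun_eq_iff)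
  then have B: "TorB E J (Suc i) j \<subseteq> BarK E J (Suc i) j"
    unfolding TorB_def using top fs.subspace_0[OF subspace_BarK]
    by (intro fs.span_minimal subspace_BarK) (auto simp: BarV_def)
  have BZ: "BarK E J (Suc i) j \<subseteq> TorZ E J (Suc i) j"
    using K BarK_subset_BarV[OF E, of J "Suc i" j] by (auto simp: TorZ_def)
  have "x \<notin> BarK E J (Suc i) j" using g gx by (auto simp: HomC_def)
  moreover have "fspan (TorB E J (Suc i) j) = TorB E J (Suc i) j"
    unfolding TorB_def by (rule fs.span_span)
  ultimately have "x \<notin> fspan (TorB E J (Suc i) j)" using B by blast
  then show "tor_dim E J (Suc i) j > 0"
    using fdim_strict_mono[OF subset_trans[OF B BZ] x _ Z] finite_Bas[OF E] by (simp add: tor_dim_def)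
  have gZ: "h \<in> ExtZ E J (Suc i) j" if "h \<in> HomC E J (Suc i) j" for h
    using that top by (auto simp: ExtZ_def cobd_def fun_eq_iff)
  have cb: "pairing E (Suc i) j (cobd E i j h) y = 0"
    if "h \<in> HomC E J i j" "y \<in> TorZ E J (Suc i) j" for h y
    using that by (subst cobd_pairing[OF E]) (auto simp: TorZ_def HomC_def)
  have "cobd E i j h t = 0" if "t \<notin> Bas E (Suc i) j" for h :: "tuple \<Rightarrow> 'k" and t
    using that by (simp add: cobd_def)
  then have "cobd E i j h \<in> HomC E J (Suc i) j" if "h \<in> HomC E J i j" for h
    using cb[OF that] BZ unfolding HomC_def by blast
  then have "ExtB E J (Suc i) j \<subseteq> ExtZ E J (Suc i) j"
    unfolding ExtB_def by (auto intro: gZ)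
  moreover have "ExtZ E J (Suc i) j \<subseteq> fspan (delta ` Bas E (Suc i) j)"
    by (auto simp: ExtZ_def HomC_def span_delta_eq[OF finite_Bas[OF E]])
  moreover have "g \<notin> fspan (ExtB E J (Suc i) j)"
  proof -
    have "functional (\<lambda>h. pairing E (Suc i) j h x)"
      by (rule functionalI) (simp_all add: pairing_def algebra_simps sum.distrib sum_distrib_left)
    then have "fspan (ExtB E J (Suc i) j) \<subseteq> {h. pairing E (Suc i) j h x = 0}"
      by (intro fs.span_minimal subspace_functional_kernel) (auto simp: ExtB_def cb[OF _ x])
    with gx show ?thesis by auto
  qed
  ultimately show "ext_dim E J (Suc i) j > 0"
    using fdim_strict_mono[OF _ gZ[OF g]] finite_Bas[OF E] by (simp add: ext_dim_def)
qed

section \<open>Elementary symmetric functions of a path\<close>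

lemma sandwich_add [simp]: "sandwich u (f + g) v = sandwich u f v + sandwich u g v"
  and sandwich_diff [simp]: "sandwich u (f - g) v = sandwich u f v - sandwich u g v"
  and sandwich_uminus [simp]: "sandwich u (- g) v = - sandwich u g v"
  and sandwich_zero [simp]: "sandwich u 0 v = 0"
  by (auto simp: sandwich_def fun_eq_iff)

lemma sandwich_Nil [simp]: "sandwich [] g [] = g"
  by (simp add: sandwich_def)

lemma sandwich_delta [simp]: "sandwich u (delta w) v = delta (u @ w @ v)"
proof
  fix x
  show "sandwich u (delta w) v x = (delta (u @ w @ v) x :: 'k::field)"
  proof (cases "length u + length v \<le> length x \<and> take (length u) x = u \<and> drop (length x - length v) x = v")
    case True
    define m where "m = take (length x - length u - length v) (drop (length u) x)"
    have "drop (length u) x = m @ v"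
      using True append_take_drop_id[of "length x - length u - length v" "drop (length u) x"]
      by (simp add: m_def add.commute)
    then have "x = u @ m @ v" using True append_take_drop_id[of "length u" x] by simp
    moreover have "sandwich u (delta w) v x = (delta w m :: 'k)" using True by (simp add: sandwich_def m_def)
    ultimately show ?thesis by (auto simp: delta_apply)
  next
    case False
    then have "x \<noteq> u @ w @ v" by auto
    with False show ?thesis by (auto simp: sandwich_def delta_apply)
  qed
qed

text \<open>Ordered subproducts are put in terms of \<open>nths\<close>, whose equation for a
  nonempty list drives the recursion for \<open>esym\<close>.\<close>

lemma map_nth_sorted_list:
  assumes "S \<subseteq> {..<length es}"
  shows "map (\<lambda>i. es ! i) (sorted_list_of_set S) = nths es S"
proof -
  have "sorted_list_of_set S = filter (\<lambda>i. i \<in> S) [0..<length es]"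
    by (rule sorted_distinct_set_unique) (use assms finite_subset[OF assms] in \<open>auto simp: sorted_wrt_filter\<close>)
  moreover have "zip es [0..<length es] = map (\<lambda>i. (es ! i, i)) [0..<length es]"
    by (rule nth_equalityI) auto
  ultimately show ?thesis by (simp add: nths_def filter_map comp_def)
qed

lemma esym_nths:
  "esym es j w = (-1) ^ j * of_nat (card {S. S \<subseteq> {..<length es} \<and> card S = j \<and> nths es S = w})"
  unfolding esym_def
  by (intro arg_cong2[of _ _ _ _ "(*)"] refl arg_cong[of _ _ of_nat] arg_cong[of _ _ card] Collect_cong)
    (auto simp: map_nth_sorted_list)

lemma esym_0 [simp]: "esym es 0 = delta []"
proof
  fix w :: word
  have "{S. S \<subseteq> {..<length es} \<and> card S = 0 \<and> nths es S = w} = (if w = [] then {{}} else {})"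
    by (auto dest: finite_subset)
  then show "esym es 0 w = (delta [] w :: 'k::field)"
    by (simp add: esym_nths delta_apply)
qed

lemma esym_length:
  assumes "esym es j w \<noteq> (0::'k::field)" shows "length w = j"
proof -
  have "card {S. S \<subseteq> {..<length es} \<and> card S = j \<and> nths es S = w} \<noteq> 0"
    using assms unfolding esym_nths by (metis mult_zero_right of_nat_0)
  then obtain S where S: "S \<subseteq> {..<length es}" "card S = j" "nths es S = w"
    by (metis (mono_tags, lifting) card.empty empty_Collect_eq)
  then have "{i. i < length es \<and> i \<in> S} = S" by auto
  with S show ?thesis using length_nths[of es S] by simp
qed

lemma esym_Nil [simp]: "esym [] (Suc j) = (0 :: word \<Rightarrow> 'k::field)"
proof -
  have "{S. S \<subseteq> {..<length ([] :: edge list)} \<and> card S = Suc j \<and> nths [] S = w} = {}" for w :: word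
    by auto
  then show ?thesis unfolding esym_nths by (simp only: card.empty) (simp add: fun_eq_iff)
qed

text \<open>This is multiplication by \<open>s - e\<close> from the left: a set of positions either
  omits position 0 or contains it, and the minus sign is the extra factor in
  \<open>(-1) ^ Suc j\<close>.\<close>

lemma esym_Cons:
  "esym (e # es) (Suc j) = (esym es (Suc j) - sandwich [e] (esym es j) [] :: word \<Rightarrow> 'k::field)"
proof
  fix w :: word
  let ?P = "\<lambda>es j w. {S. S \<subseteq> {..<length es} \<and> card S = j \<and> nths es S = w}"
  let ?T = "{T. T \<subseteq> {..<length es} \<and> card T = j \<and> e # nths es T = w}"
  have fin: "finite (?P es j w)" for es j and w :: word
    by (rule finite_subset[of _ "Pow {..<length es}"]) auto
  have finT: "finite ?T"
    by (rule finite_subset[of _ "Pow {..<length es}"]) auto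
  have inj: "inj_on ((`) Suc) X" for X :: "nat set set"
    by (rule inj_onI) (simp add: inj_image_eq_iff)
  have inj': "inj_on (\<lambda>T. insert 0 (Suc ` T)) X" for X :: "nat set set"
  proof (rule inj_onI)
    fix A B assume "insert 0 (Suc ` A) = insert 0 (Suc ` B)"
    then have "Suc ` A = Suc ` B" by (simp add: insert_ident)
    then show "A = B" by (simp add: inj_image_eq_iff)
  qed
  have nS: "nths (e # es) (Suc ` T) = nths es T" "nths (e # es) (insert 0 (Suc ` T)) = e # nths es T" for T
    using inj_image_mem_iff[of Suc] by (auto simp: nths_Cons)
  have cS: "card (Suc ` T) = card T" "finite T \<Longrightarrow> card (insert 0 (Suc ` T)) = Suc (card T)" for T
    by (simp_all add: card_image)
  have split: "?P (e # es) (Suc j) w = (`) Suc ` ?P es (Suc j) w \<union> (\<lambda>T. insert 0 (Suc ` T)) ` ?T"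
  proof (intro equalityI subsetI)
    fix S assume S: "S \<in> ?P (e # es) (Suc j) w"
    define T where "T = {i. Suc i \<in> S}"
    have T: "T \<subseteq> {..<length es}" using S by (auto simp: T_def)
    then have fT: "finite T" by (rule finite_subset) simp
    show "S \<in> (`) Suc ` ?P es (Suc j) w \<union> (\<lambda>T. insert 0 (Suc ` T)) ` ?T"
    proof (cases "0 \<in> S")
      case True
      have "n \<in> S \<longleftrightarrow> n \<in> insert 0 (Suc ` T)" for n
        using True by (cases n) (auto simp: T_def)
      then have "S = insert 0 (Suc ` T)" by blast
      with S T show ?thesis using cS(2)[OF fT] by (auto simp: nS)
    next
      case False
      have "n \<in> S \<longleftrightarrow> n \<in> Suc ` T" for n
        using False by (cases n) (auto simp: T_def)
      then have "S = Suc ` T" by blast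
      with S T show ?thesis by (auto simp: nS cS)
    qed
  next
    fix S assume "S \<in> (`) Suc ` ?P es (Suc j) w \<union> (\<lambda>T. insert 0 (Suc ` T)) ` ?T"
    then show "S \<in> ?P (e # es) (Suc j) w"
      by (auto simp: nS cS finite_subset)
  qed
  have "card (?P (e # es) (Suc j) w) = card (?P es (Suc j) w) + card ?T"
    unfolding split
    by (subst card_Un_disjoint) (auto simp: card_image inj inj' fin finT)
  moreover have "?T = (case w of [] \<Rightarrow> {} | x # w' \<Rightarrow> if x = e then ?P es j w' else {})"
    by (auto split: list.split)
  moreover have "sandwich [e] (esym es j) [] w
      = (case w of [] \<Rightarrow> (0 :: 'k) | x # w' \<Rightarrow> if x = e then esym es j w' else 0)"
    by (auto simp: sandwich_def split: list.split)
  ultimately show "esym (e # es) (Suc j) w = (esym es (Suc j) - sandwich [e] (esym es j) [] :: word \<Rightarrow> 'k) w"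
    by (auto simp: esym_nths algebra_simps split: list.split)
qed

section \<open>Ranks\<close>

text \<open>\<open>r\<close> maps a maximal chain bijectively onto \<open>{..r x}\<close>. At a
  missing value, \<open>dense\<close> would give a vertex between the two neighbours of the gap that
  is comparable with the whole chain, against maximality.\<close>

lemma card_maximal_chain:
  assumes po: "is_poset V le" and fin: "finite V" and z0: "z0 \<in> V" "\<And>x. x \<in> V \<Longrightarrow> le z0 x" and r0: "r z0 = 0"
    and mono: "\<And>x y. x \<in> V \<Longrightarrow> y \<in> V \<Longrightarrow> lt le x y \<Longrightarrow> r x < (r y :: nat)"
    and dense: "\<And>x y. x \<in> V \<Longrightarrow> y \<in> V \<Longrightarrow> lt le x y \<Longrightarrow> r x + 1 < r y \<Longrightarrow> \<exists>z\<in>V. lt le x z \<and> lt le z y"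
    and x: "x \<in> V" and C: "maximal_chain_in le (interval V le z0 x) C"
  shows "card C = Suc (r x)"
proof -
  let ?S = "interval V le z0 x"
  have refl: "le a a" if "a \<in> V" for a using po that by (auto simp: is_poset_def)
  have trans: "le a c" if "a \<in> V" "b \<in> V" "c \<in> V" "le a b" "le b c" for a b c
    using po that unfolding is_poset_def by blast
  have CS: "C \<subseteq> ?S" and CV: "C \<subseteq> V" and chain: "\<And>a b. a \<in> C \<Longrightarrow> b \<in> C \<Longrightarrow> le a b \<or> le b a"
    using C by (auto simp: maximal_chain_in_def is_chain_def interval_def)
  have max: "z \<in> C" if "z \<in> ?S" "\<And>c. c \<in> C \<Longrightarrow> le c z \<or> le z c" for z
  proof -
    have "is_chain le (insert z C)" "insert z C \<subseteq> ?S"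
      using chain that CS refl[of z] by (auto simp: is_chain_def interval_def)
    then show ?thesis using C unfolding maximal_chain_in_def by blast
  qed
  have z0C: "z0 \<in> C" using CV z0 x by (intro max) (auto simp: interval_def refl)
  have xC: "x \<in> C" using CS z0 x by (intro max) (auto simp: interval_def refl)
  have fC: "finite C" using CV fin by (rule finite_subset)
  have le_r: "le a b" if "a \<in> C" "b \<in> C" "r a \<le> r b" for a b
    using chain[OF that(1,2)] mono[of b a] that CV refl by (auto simp: lt_def)
  have inj: "inj_on r C"
    by (rule inj_onI) (metis (mono_tags) CV chain less_irrefl lt_def mono subsetD)
  have "r ` C = {..r x}"
  proof (intro equalityI subsetI)
    fix n assume "n \<in> r ` C"
    then obtain c where c: "c \<in> C" "n = r c" by auto
    then have "le c x" "c \<in> V" using CS by (auto simp: interval_def)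
    then show "n \<in> {..r x}" using mono[of c x] x c by (cases "c = x") (auto simp: lt_def)
  next
    fix n assume n: "n \<in> {..r x}"
    show "n \<in> r ` C"
    proof (rule ccontr)
      assume nC: "n \<notin> r ` C"
      \<comment> \<open>The chain is split at the missing value \<open>n\<close>. The elements
        \<open>a\<close> and \<open>b\<close> next to the gap have ranks differing by at least 2, as
        \<open>dense\<close> requires.\<close>
      let ?L = "{c \<in> C. r c < n}" and ?U = "{c \<in> C. n < r c}"
      have "z0 \<in> ?L" "x \<in> ?U" using z0C xC r0 n nC by (auto simp: image_iff)
      then have mm: "Max (r ` ?L) \<in> r ` ?L" "Min (r ` ?U) \<in> r ` ?U"
        using fC by (intro Max_in Min_in; force)+
      from mm(1) obtain a where a0: "Max (r ` ?L) = r a" "a \<in> ?L" by (rule imageE)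
      from mm(2) obtain b where b0: "Min (r ` ?U) = r b" "b \<in> ?U" by (rule imageE)
      have a: "a \<in> ?L" "\<And>c. c \<in> ?L \<Longrightarrow> r c \<le> r a" and b: "b \<in> ?U" "\<And>c. c \<in> ?U \<Longrightarrow> r b \<le> r c"
        using a0 b0 fC by (simp_all flip: a0(1) b0(1))
      have "a \<noteq> b" "a \<in> V" "b \<in> V" using a b CV by auto
      moreover have "le a b" using a b by (intro le_r) auto
      ultimately obtain z where z: "z \<in> V" "lt le a z" "lt le z b"
        using dense[of a b] a b by (auto simp: lt_def)
      have rz: "r a < r z" "r z < r b" using mono z \<open>a \<in> V\<close> \<open>b \<in> V\<close> by auto
      have "z \<in> C"
      proof (rule max)
        have "le z x" using trans[OF z(1) \<open>b \<in> V\<close> x] z(3) b(1) CS by (auto simp: lt_def interval_def)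
        then show "z \<in> ?S" using z z0 by (auto simp: interval_def)
        fix c assume c: "c \<in> C"
        then consider "r c < n" | "n < r c" using nC by (metis image_eqI linorder_neqE_nat)
        then show "le c z \<or> le z c"
        proof cases
          case 1
          then have "le c a" using a c by (intro le_r) auto
          then show ?thesis using trans[of c a z] c CV z \<open>a \<in> V\<close> by (auto simp: lt_def)
        next
          case 2
          then have "le b c" using b c by (intro le_r) auto
          then show ?thesis using trans[of z b c] c CV z \<open>b \<in> V\<close> by (auto simp: lt_def)
        qed
      qed
      then show False using a(2)[of z] b(2)[of z] rz nC by (cases "r z" n rule: linorder_cases) auto
    qed
  qed
  then have "card (r ` C) = Suc (r x)" by simp
  then show ?thesis using card_image[OF inj] by simp
qed

lemma ex_maximal_chain:
  assumes "finite S" obtains C where "maximal_chain_in le S C"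
proof -
  let ?X = "{C. C \<subseteq> S \<and> is_chain le C}"
  have "finite ?X" using assms by (auto intro: finite_subset[of _ "Pow S"])
  moreover have "?X \<noteq> {}" by (auto simp: is_chain_def)
  ultimately obtain C where "C \<in> ?X" "\<forall>D\<in>?X. C \<subseteq> D \<longrightarrow> C = D"
    by (rule finite_has_maximal[THEN bexE])
  then show thesis by (intro that[of C]) (auto simp: maximal_chain_in_def)
qed

lemma ranked_posetI:
  assumes po: "is_poset V le" and fin: "finite V" and z0: "z0 \<in> V" "\<And>x. x \<in> V \<Longrightarrow> le z0 x" and r0: "r z0 = 0"
    and mono: "\<And>x y. x \<in> V \<Longrightarrow> y \<in> V \<Longrightarrow> lt le x y \<Longrightarrow> r x < (r y :: nat)"
    and dense: "\<And>x y. x \<in> V \<Longrightarrow> y \<in> V \<Longrightarrow> lt le x y \<Longrightarrow> r x + 1 < r y \<Longrightarrow> \<exists>z\<in>V. lt le x z \<and> lt le z y"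
  shows "ranked_poset V le z0" "\<And>x. x \<in> V \<Longrightarrow> rk V le z0 x = r x"
proof -
  have card: "card C = Suc (r x)" if "x \<in> V" "maximal_chain_in le (interval V le z0 x) C" for x C
    by (rule card_maximal_chain[where r = r]; fact)
  have "is_minimal V le m \<longleftrightarrow> m = z0" for m
    using po z0 unfolding is_minimal_def is_poset_def by blast
  then show "ranked_poset V le z0"
    using po fin card unfolding ranked_poset_def by auto
  fix x assume x: "x \<in> V"
  have "finite (interval V le z0 x)" using fin by (simp add: interval_def)
  then obtain C where "maximal_chain_in le (interval V le z0 x) C" by (rule ex_maximal_chain)
  with card[OF x] show "rk V le z0 x = r x"
    unfolding rk_def by (intro the_equality) fastforce+
qed

section \<open>The poset\<close>

definition rank8 :: "nat \<Rightarrow> nat" where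
  "rank8 x = (x + 1) div 2"

text \<open>Both excluded pairs lie in adjacent ranks, where no third vertex can force them back by
  transitivity. They leave 1 as the only vertex covered by 3 and 2 as the only one covered by
  4.\<close>

definition le8 :: "nat \<Rightarrow> nat \<Rightarrow> bool" where
  "le8 x y \<longleftrightarrow> x = y \<or> rank8 x < rank8 y \<and> (x, y) \<noteq> (1, 4) \<and> (x, y) \<noteq> (2, 3)"

definition V8 :: "nat set" where
  "V8 = {0, 1, 2, 3, 4, 5, 6, 7}"

definition E8 :: "edge set" where
  "E8 = {(1,0), (2,0), (3,1), (4,2), (5,3), (5,4), (6,3), (6,4), (7,5), (7,6)}"

lemma finite_E8 [simp]: "finite E8"
  by (simp add: E8_def)

lemma le8_poset: "is_poset V8 le8"
proof -
  have "le8 x z" if "le8 x y" "le8 y z" for x y z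
    using that by (auto simp: le8_def rank8_def)
  moreover have "x = y" if "le8 x y" "le8 y x" for x y
    using that by (auto simp: le8_def)
  moreover have "le8 x x" for x by (simp add: le8_def)
  ultimately show ?thesis unfolding is_poset_def by metis
qed

lemma
  shows ranked_V8: "ranked_poset V8 le8 0" and rk_V8: "\<And>x. x \<in> V8 \<Longrightarrow> rk V8 le8 0 x = rank8 x"
proof -
  have dense: "\<forall>x\<in>V8. \<forall>y\<in>V8. lt le8 x y \<longrightarrow> rank8 x + 1 < rank8 y \<longrightarrow> (\<exists>z\<in>V8. lt le8 x z \<and> lt le8 z y)"
    by (simp add: V8_def lt_def le8_def rank8_def)
  have least: "le8 0 x" for x by (cases "x = 0") (auto simp: le8_def rank8_def)
  have mono: "rank8 x < rank8 y" if "lt le8 x y" for x y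
    using that by (auto simp: lt_def le8_def)
  show "ranked_poset V8 le8 0" "\<And>x. x \<in> V8 \<Longrightarrow> rk V8 le8 0 x = rank8 x"
    by (rule ranked_posetI[where r = rank8, OF le8_poset]; use dense least mono in \<open>blast | simp add: V8_def rank8_def\<close>)+
qed

lemma Edges_V8: "Edges V8 le8 0 = E8"
proof -
  have "covers V8 le8 0 x y \<longleftrightarrow> x \<in> V8 \<and> y \<in> V8 \<and> lt le8 y x \<and> rank8 x = rank8 y + 1" for x y
    unfolding covers_def using rk_V8 by metis
  then have "Edges V8 le8 0 = {(x, y). x \<in> V8 \<and> y \<in> V8 \<and> lt le8 y x \<and> rank8 x = rank8 y + 1}"
    by (simp add: Edges_def)
  also have "\<dots> = E8"
  proof -
    have "\<forall>x\<in>V8. \<forall>y\<in>V8. lt le8 y x \<and> rank8 x = rank8 y + 1 \<longleftrightarrow> (x, y) \<in> E8"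
      by (simp add: V8_def E8_def lt_def le8_def rank8_def)
    moreover have "E8 \<subseteq> V8 \<times> V8" by (auto simp: V8_def E8_def)
    ultimately show ?thesis by auto
  qed
  finally show ?thesis .
qed

lemma covers_V8: "covers V8 le8 0 x y \<longleftrightarrow> (x, y) \<in> E8"
  using Edges_V8 by (auto simp: Edges_def)

lemma E8_V8: "e \<in> E8 \<Longrightarrow> fst e \<in> V8"
  by (auto simp: V8_def E8_def)

definition wt8 :: "word \<Rightarrow> nat" where
  "wt8 w = sum_list (map (\<lambda>e. rank8 (fst e)) w)"

lemma wt8_simps [simp]: "wt8 [] = 0" "wt8 (e # w) = rank8 (fst e) + wt8 w" "wt8 (u @ w) = wt8 u + wt8 w"
  by (simp_all add: wt8_def)

lemma wt_V8: "set w \<subseteq> E8 \<Longrightarrow> wt V8 le8 0 w = wt8 w"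
  unfolding wt_def wt8_def using rk_V8 E8_V8
  by (intro arg_cong[of _ _ sum_list] map_cong) auto

abbreviation I8 :: "(word \<Rightarrow> 'k::field) set" where "I8 \<equiv> idealI V8 le8 0"
abbreviation L8 :: "(word \<Rightarrow> 'k::field) set" where "L8 \<equiv> leadI V8 le8 0"
abbreviation G8 :: "(word \<Rightarrow> 'k::field) set" where "G8 \<equiv> gens V8 le8 0"

section \<open>Edge lists of paths\<close>

lemma path_edges_Cons: "path_edges (b # c # cs) = (b, c) # path_edges (c # cs)"
proof -
  have "[0..<length (b # c # cs) - 1] = 0 # map Suc [0..<length (c # cs) - 1]"
    by (simp add: map_Suc_upt upt_conv_Cons del: upt_Suc)
  then show ?thesis unfolding path_edges_def by (simp add: comp_def del: upt_Suc)
qed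

lemma path_edges_singleton: "path_edges [b] = []"
  by (simp add: path_edges_def)

lemma is_path_Cons:
  "is_path V le z0 b a (c # c' # cs) \<longleftrightarrow> c = b \<and> covers V le z0 b c' \<and> is_path V le z0 c' a (c' # cs)"
proof
  assume p: "is_path V le z0 b a (c # c' # cs)"
  have i: "covers V le z0 ((c # c' # cs) ! i) ((c # c' # cs) ! Suc i)" if "Suc i < length (c # c' # cs)" for i
    using p that unfolding is_path_def by blast
  have "covers V le z0 ((c' # cs) ! i) ((c' # cs) ! Suc i)" if "Suc i < length (c' # cs)" for i
    using i[of "Suc i"] that by simp
  with p i[of 0] show "c = b \<and> covers V le z0 b c' \<and> is_path V le z0 c' a (c' # cs)"
    by (simp add: is_path_def)
next
  assume *: "c = b \<and> covers V le z0 b c' \<and> is_path V le z0 c' a (c' # cs)"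
  have "covers V le z0 ((c # c' # cs) ! i) ((c # c' # cs) ! Suc i)" if "Suc i < length (c # c' # cs)" for i
    using * that by (cases i) (auto simp: is_path_def)
  with * show "is_path V le z0 b a (c # c' # cs)" by (auto simp: is_path_def)
qed

lemma is_path_singleton: "is_path V le z0 b a [c] \<longleftrightarrow> c = b \<and> a = b"
  by (auto simp: is_path_def)

section \<open>Degrees one and two of the ideal\<close>

text \<open>\<open>H\<close> acts as a potential: an edge gets the drop of \<open>H\<close> along
  it, so the sum over a path depends only on its ends. This is why \<open>lin H\<close> vanishes on
  the linear relations.\<close>

definition lin :: "(nat \<Rightarrow> 'k) \<Rightarrow> (word \<Rightarrow> 'k::field) \<Rightarrow> 'k" where
  "lin H f = (\<Sum>e\<in>E8. (H (fst e) - H (snd e)) * f [e])"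

definition quad :: "(nat \<Rightarrow> 'k) \<Rightarrow> (nat \<Rightarrow> 'k) \<Rightarrow> (word \<Rightarrow> 'k::field) \<Rightarrow> 'k" where
  "quad H H' f = (\<Sum>e\<in>E8. \<Sum>e'\<in>E8. (H (fst e) - H (snd e)) * (H' (fst e') - H' (snd e')) * f [e, e'])"

lemma lin_add [simp]: "lin H (f + g) = lin H f + lin H g"
  and lin_diff [simp]: "lin H (f - g) = lin H f - lin H g"
  and lin_zero [simp]: "lin H 0 = 0"
  and lin_fsc [simp]: "lin H (fsc c f) = c * lin H f"
  by (simp_all add: lin_def algebra_simps sum.distrib sum_subtractf sum_distrib_left)

lemma quad_add [simp]: "quad H H' (f + g) = quad H H' f + quad H H' g"
  and quad_diff [simp]: "quad H H' (f - g) = quad H H' f - quad H H' g"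
  and quad_zero [simp]: "quad H H' 0 = 0"
  and quad_fsc [simp]: "quad H H' (fsc c f) = c * quad H H' f"
  by (simp_all add: quad_def distrib_left right_diff_distrib sum.distrib sum_subtractf sum_distrib_left mult_ac)

lemma lin_delta [simp]: "e \<in> E8 \<Longrightarrow> lin H (delta [e]) = H (fst e) - H (snd e)"
proof -
  assume e: "e \<in> E8"
  have "lin H (delta [e]) = (\<Sum>e'\<in>E8. if e' = e then H (fst e') - H (snd e') else 0)"
    unfolding lin_def by (rule sum.cong) (auto simp: delta_apply)
  with e show ?thesis by simp
qed

lemma quad_sandwich_left:
  assumes "e \<in> E8" shows "quad H H' (sandwich [e] f []) = (H (fst e) - H (snd e)) * lin H' f"
proof -
  have "sandwich [e] f [] [x, y] = (if x = e then f [y] else 0)" for x y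
    by (simp add: sandwich_def)
  then have "quad H H' (sandwich [e] f []) = (\<Sum>x\<in>E8. if x = e then (H (fst e) - H (snd e)) * lin H' f else 0)"
    unfolding quad_def lin_def by (intro sum.cong refl) (auto simp: sum_distrib_left mult_ac)
  with assms show ?thesis by simp
qed

lemma quad_sandwich_right:
  assumes "e \<in> E8" shows "quad H H' (sandwich [] f [e]) = lin H f * (H' (fst e) - H' (snd e))"
proof -
  have s: "sandwich [] f [e] [x, y] = (if y = e then f [x] else 0)" for x y
    by (simp add: sandwich_def)
  have "quad H H' (sandwich [] f [e])
      = (\<Sum>x\<in>E8. \<Sum>y\<in>E8. if y = e then (H (fst x) - H (snd x)) * (H' (fst e) - H' (snd e)) * f [x] else 0)"
    unfolding quad_def s by (intro sum.cong refl) auto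
  with assms show ?thesis by (simp add: lin_def sum_distrib_left sum_distrib_right mult_ac)
qed

text \<open>The condition \<open>a \<noteq> 0\<close> normalises every potential to 0 at the bottom
  vertex, so that only nonzero vertices carry coordinates.\<close>

definition chi :: "nat \<Rightarrow> nat \<Rightarrow> 'k::field" where
  "chi a x = (if x = a \<and> a \<noteq> 0 then 1 else 0)"

lemma chi_0 [simp]: "chi a 0 = 0"
  by (auto simp: chi_def)

text \<open>The classes of \<open>e(\<pi>, 1)\<close> for the paths \<open>\<pi>\<close> from a vertex \<open>x \<noteq> 0\<close> to \<open>0\<close> form a basis of the
  degree one part of the splitting algebra, and the edge \<open>x \<rightarrow> y\<close> is the difference of the basis
  vectors at \<open>x\<close> and \<open>y\<close>; \<open>chi a\<close> is the coordinate at \<open>a\<close>. In these coordinates \<open>pot x\<close> is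
  \<open>e(\<pi>, 2)\<close> for one chosen path from \<open>x\<close> to \<open>0\<close>, and \<open>et x y\<close> is the product of the edge \<open>x \<rightarrow> y\<close> and
  the basis vector at \<open>y\<close>.\<close>
definition et :: "nat \<Rightarrow> nat \<Rightarrow> nat \<Rightarrow> nat \<Rightarrow> 'k::field" where
  "et x y a b = (chi a x - chi a y) * chi b y"

definition pot :: "nat \<Rightarrow> nat \<Rightarrow> nat \<Rightarrow> 'k::field" where
  "pot x a b =
    (if x = 3 then et 3 1 a b
     else if x = 4 then et 4 2 a b
     else if x = 5 then et 5 3 a b + et 3 1 a b
     else if x = 6 then et 6 3 a b + et 3 1 a b
     else if x = 7 then et 7 5 a b + et 5 3 a b + et 3 1 a b
     else 0)"

text \<open>The chosen path from \<open>x\<close> is compared with the edge to \<open>y\<close>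
  followed by the chosen path from \<open>y\<close>. The result is zero for the seven edges lying on
  chosen paths, which form a spanning tree, and nonzero for \<open>(5, 4)\<close>,
  \<open>(6, 4)\<close> and \<open>(7, 6)\<close>.\<close>

definition rel :: "nat \<Rightarrow> nat \<Rightarrow> nat \<Rightarrow> nat \<Rightarrow> 'k::field" where
  "rel x y a b = pot x a b - et x y a b - pot y a b"

text \<open>The quadratic relations in coordinates on \<open>V \<otimes> V\<close>, one generator
  for each edge outside the tree of chosen paths.\<close>

definition R8 :: "(nat \<Rightarrow> nat \<Rightarrow> 'k::field) set" where
  "R8 = {Y. \<exists>c7 c5 c6. \<forall>a b. Y a b = c7 * rel 7 6 a b + c5 * rel 5 4 a b + c6 * rel 6 4 a b}"

lemma R8_zero [simp]: "(\<lambda>a b. 0) \<in> R8"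
  unfolding R8_def by (intro CollectI exI[of _ 0]) simp

lemma R8_add: "Y \<in> R8 \<Longrightarrow> Y' \<in> R8 \<Longrightarrow> (\<lambda>a b. Y a b + Y' a b) \<in> R8"
proof -
  assume "Y \<in> R8" "Y' \<in> R8"
  then obtain c7 c5 c6 d7 d5 d6 where
    "\<forall>a b. Y a b = c7 * rel 7 6 a b + c5 * rel 5 4 a b + c6 * rel 6 4 a b"
    "\<forall>a b. Y' a b = d7 * rel 7 6 a b + d5 * rel 5 4 a b + d6 * rel 6 4 a b" unfolding R8_def by blast
  then show ?thesis unfolding R8_def
    by (intro CollectI exI[of _ "c7 + d7"] exI[of _ "c5 + d5"] exI[of _ "c6 + d6"]) (simp add: algebra_simps)
qed

lemma R8_scale: "Y \<in> R8 \<Longrightarrow> (\<lambda>a b. c * Y a b) \<in> R8"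
proof -
  assume "Y \<in> R8"
  then obtain c7 c5 c6 where
    "\<forall>a b. Y a b = c7 * rel 7 6 a b + c5 * rel 5 4 a b + c6 * rel 6 4 a b" unfolding R8_def by blast
  then show ?thesis unfolding R8_def
    by (intro CollectI exI[of _ "c * c7"] exI[of _ "c * c5"] exI[of _ "c * c6"]) (simp add: algebra_simps)
qed

lemma R8_diff: "Y \<in> R8 \<Longrightarrow> Y' \<in> R8 \<Longrightarrow> (\<lambda>a b. Y a b - Y' a b) \<in> R8"
  using R8_add[OF _ R8_scale[of Y' "-1"], of Y] by simp

lemma rel_R8:
  assumes "(x, y) \<in> E8" shows "(rel x y :: nat \<Rightarrow> nat \<Rightarrow> 'k::field) \<in> R8"
proof -
  have z: "Y \<in> R8" if "\<And>a b. Y a b = (0 :: 'k)" for Y using that unfolding R8_def by (intro CollectI exI[of _ 0]) simp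
  have "rel 7 6 \<in> R8" "rel 5 4 \<in> R8" "rel 6 4 \<in> (R8 :: (nat \<Rightarrow> nat \<Rightarrow> 'k) set)"
    unfolding R8_def
    by (intro CollectI exI[of _ 1] exI[of _ 0]; simp) (intro CollectI exI[of _ 0] exI[of _ 1]; simp)+
  moreover have "(x, y) \<in> {(7, 6), (5, 4), (6, 4)} \<or> (x, y) \<in> {(1,0), (2,0), (3,1), (4,2), (5,3), (6,3), (7,5)}"
    using assms by (auto simp: E8_def)
  moreover have "rel x y a b = (0 :: 'k)"
    if "(x, y) \<in> {(1,0), (2,0), (3,1), (4,2), (5,3), (6,3), (7,5)}" for a b
    using that by (auto simp: rel_def pot_def et_def)
  ultimately show ?thesis using z by blast
qed

text \<open>The third claim is the product rule for a path from \<open>b\<close> to \<open>x\<close>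
  continued by the chosen path to 0: the second coefficient of the whole is the sum of the second
  coefficients of the two pieces and the product of their first coefficients. Each edge of the path
  contributes an error \<open>rel\<close>, hence modulo \<open>R8\<close> only the ends
  matter.\<close>

lemma path_E8:
  fixes H :: "nat \<Rightarrow> 'k::field"
  assumes "is_path V8 le8 0 b x cs"
  shows "set (path_edges cs) \<subseteq> E8"
    and "lin H (esym (path_edges cs) 1) = H x - H b"
    and "(\<lambda>p q. quad (chi p) (chi q) (esym (path_edges cs) 2)
            - (pot b p q - pot x p q - (chi p b - chi p x) * chi q x)) \<in> (R8 :: (nat \<Rightarrow> nat \<Rightarrow> 'k) set)"
proof -
  have "set (path_edges cs) \<subseteq> E8 \<and> (\<forall>H :: nat \<Rightarrow> 'k. lin H (esym (path_edges cs) (Suc 0)) = H x - H b)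
     \<and> (\<lambda>p q. quad (chi p) (chi q) (esym (path_edges cs) (Suc (Suc 0)))
            - (pot b p q - pot x p q - (chi p b - chi p x) * chi q x)) \<in> (R8 :: (nat \<Rightarrow> nat \<Rightarrow> 'k) set)"
    using assms
  proof (induction cs arbitrary: b rule: induct_list012)
    case 1
    then show ?case by (simp add: is_path_def)
  next
    case (2 c)
    then show ?case by (auto simp: is_path_singleton path_edges_singleton lin_def quad_def)
  next
    case (3 c c' cs)
    from 3(3) have c: "c = b" "(b, c') \<in> E8" "is_path V8 le8 0 c' x (c' # cs)"
      by (auto simp: is_path_Cons covers_V8)
    note IH = 3(2)[OF c(3)]
    have lin1: "lin H (esym (path_edges (c # c' # cs)) (Suc 0)) = H x - H b" for H :: "nat \<Rightarrow> 'k"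
      using IH c by (simp add: path_edges_Cons esym_Cons)
    have lin1': "lin H (esym (path_edges (c' # cs)) (Suc 0)) = H x - H c'" for H :: "nat \<Rightarrow> 'k"
      using IH by simp
    have step: "quad (chi p) (chi q) (esym (path_edges (c # c' # cs)) (Suc (Suc 0)))
            - (pot b p q - pot x p q - (chi p b - chi p x) * chi q x)
        = (quad (chi p) (chi q) (esym (path_edges (c' # cs)) (Suc (Suc 0)))
            - (pot c' p q - pot x p q - (chi p c' - chi p x) * chi q x)) - (rel b c' p q :: 'k)" for p q
      using c(1,2) by (simp add: path_edges_Cons esym_Cons[of _ _ "Suc 0"] lin1' quad_sandwich_left rel_def et_def algebra_simps)
    have "(\<lambda>p q. quad (chi p) (chi q) (esym (path_edges (c # c' # cs)) (Suc (Suc 0)))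
            - (pot b p q - pot x p q - (chi p b - chi p x) * chi q x :: 'k)) \<in> R8"
      unfolding step by (rule R8_diff[OF conjunct2[OF conjunct2[OF IH]] rel_R8[OF c(2)]])
    with lin1 IH c show ?case by (simp add: path_edges_Cons)
  qed
  then show "set (path_edges cs) \<subseteq> E8" "lin H (esym (path_edges cs) 1) = H x - H b"
    "(\<lambda>p q. quad (chi p) (chi q) (esym (path_edges cs) 2)
            - (pot b p q - pot x p q - (chi p b - chi p x) * chi q x)) \<in> (R8 :: (nat \<Rightarrow> nat \<Rightarrow> 'k) set)"
    by (simp_all add: numeral_2_eq_2)
qed

lemma lin_esym_0: "j \<noteq> 1 \<Longrightarrow> lin H (esym es j) = 0"
  unfolding lin_def using esym_length[of es j] by (intro sum.neutral) fastforce

lemma quad_esym_0: "j \<noteq> 2 \<Longrightarrow> quad H H' (esym es j) = 0"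
  unfolding quad_def using esym_length[of es j] by (intro sum.neutral ballI) fastforce

lemma gens_props:
  fixes H :: "nat \<Rightarrow> 'k::field"
  assumes "g \<in> (G8 :: (word \<Rightarrow> 'k) set)"
  shows "g [] = 0" "lin H g = 0" "(\<lambda>p q. quad (chi p) (chi q) g) \<in> R8"
proof -
  from assms obtain a b p q j where g: "g = esym (path_edges p) j - esym (path_edges q) j"
    and p: "is_path V8 le8 0 b a p" and q: "is_path V8 le8 0 b a q"
    unfolding gens_def by blast
  show "g [] = 0"
  proof (cases j)
    case (Suc n)
    then have "esym es j [] = (0 :: 'k)" for es using esym_length[of es j "[]"] by fastforce
    then show ?thesis by (simp add: g)
  qed (simp add: g)
  show "lin H g = 0"
    using path_E8(2)[OF p, of H] path_E8(2)[OF q, of H] by (cases "j = 1") (simp_all add: g lin_esym_0)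
  show "(\<lambda>p q. quad (chi p) (chi q) g) \<in> R8"
  proof (cases "j = 2")
    case True
    then show ?thesis using R8_diff[OF path_E8(3)[OF p] path_E8(3)[OF q]] by (simp add: g)
  qed (simp add: g quad_esym_0)
qed

text \<open>Generators have no constant term and no linear coordinates. In degree two a product
  \<open>u g v\<close> with one extra letter therefore has \<open>quad\<close> equal to a product of
  two linear values, one of them zero, and only the generators themselves contribute.\<close>

lemma ideal_props:
  fixes H :: "nat \<Rightarrow> 'k::field"
  assumes "f \<in> (I8 :: (word \<Rightarrow> 'k) set)"
  shows "lin H f = 0" "(\<lambda>p q. quad (chi p) (chi q) f) \<in> R8"
proof -
  let ?S = "{f :: word \<Rightarrow> 'k. (\<forall>H :: nat \<Rightarrow> 'k. lin H f = 0) \<and> (\<lambda>p q. quad (chi p) (chi q) f) \<in> R8}"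
  have "I8 \<subseteq> ?S"
    unfolding idealI_def Edges_V8
  proof (rule fs.span_minimal)
    show "fs.subspace ?S"
      by (rule fs.subspaceI) (auto simp: R8_add R8_scale)
    show "{sandwich u g v | u g v. set u \<subseteq> E8 \<and> set v \<subseteq> E8 \<and> g \<in> G8} \<subseteq> ?S"
    proof clarify
      fix u v and g :: "word \<Rightarrow> 'k" assume uv: "set u \<subseteq> E8" "set v \<subseteq> E8" and g: "g \<in> G8"
      note gp = gens_props[OF g]
      have s: "sandwich u g v w = 0" if "length u + length v \<ge> length w" for w
        using that gp(1) by (simp add: sandwich_def)
      have l: "lin H (sandwich u g v) = 0" if "length u + length v \<noteq> 0" for H :: "nat \<Rightarrow> 'k"
        unfolding lin_def using that by (intro sum.neutral ballI) (simp add: s Suc_le_eq)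
      have q: "quad H H' (sandwich u g v) = 0" if "length u + length v \<ge> 2" for H H' :: "nat \<Rightarrow> 'k"
        unfolding quad_def using that by (intro sum.neutral ballI) (simp add: s)
      consider "u = []" "v = []" | e where "u = [e]" "v = []" | e where "u = []" "v = [e]"
        | "length u + length v \<ge> 2"
        by (cases u; cases v; cases "tl u"; cases "tl v") auto
      then show "(\<forall>H :: nat \<Rightarrow> 'k. lin H (sandwich u g v) = 0) \<and> (\<lambda>p q. quad (chi p) (chi q) (sandwich u g v)) \<in> R8"
      proof cases
        case 1
        then show ?thesis using gp by simp
      next
        case 2
        then show ?thesis using gp l uv by (simp add: quad_sandwich_left)
      next
        case 3
        then show ?thesis using gp l uv by (simp add: quad_sandwich_right)
      next
        case 4
        then have "lin H (sandwich u g v) = 0" for H :: "nat \<Rightarrow> 'k" by (intro l) linarith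
        with 4 show ?thesis using q by simp
      qed
    qed
  qed
  with assms show "lin H f = 0" "(\<lambda>p q. quad (chi p) (chi q) f) \<in> R8" by auto
qed

text \<open>This is \<open>(R \<otimes> V) \<inter> (V \<otimes> R) = 0\<close>, in coordinates.\<close>
lemma R8_overlap:
  fixes X :: "nat \<Rightarrow> nat \<Rightarrow> nat \<Rightarrow> 'k::field"
  assumes left: "\<And>c. (\<lambda>a b. X a b c) \<in> R8" and right: "\<And>a. (\<lambda>b c. X a b c) \<in> R8"
  shows "X a b c = 0"
proof -
  \<comment> \<open>The entries at \<open>(7, 5)\<close>, \<open>(5, 3)\<close> and
    \<open>(6, 3)\<close> determine a member of \<open>R8\<close>, so both slicings become explicit
    linear equations for \<open>X\<close>.\<close>
  have expand: "Y a b = Y 7 5 * rel 7 6 a b + (Y 5 3 - Y 7 5) * rel 5 4 a b + (Y 6 3 + Y 7 5) * rel 6 4 a b"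
    if Y: "Y \<in> R8" for Y :: "nat \<Rightarrow> nat \<Rightarrow> 'k" and a b
  proof -
    from Y obtain c7 c5 c6 where
      c: "\<And>a b. Y a b = c7 * rel 7 6 a b + c5 * rel 5 4 a b + c6 * rel 6 4 a b" unfolding R8_def by blast
    have "Y 7 5 = c7" "Y 5 3 = c7 + c5" "Y 6 3 = c6 - c7"
      by (simp_all add: c rel_def pot_def et_def chi_def)
    then show ?thesis by (simp add: c)
  qed
  note l = expand[OF left] and r = expand[OF right]
  note ev = rel_def pot_def et_def chi_def
  have X775: "X 7 7 5 = 0" using l[of 7 7 5] by (simp add: ev)
  have X575: "X 5 7 5 = 0" using l[of 5 7 5] by (simp add: ev)
  have X675: "X 6 7 5 = 0" using l[of 6 7 5] by (simp add: ev)
  have X563: "X 5 6 3 = 0" using l[of 5 6 3] by (simp add: ev)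
  have X653: "X 6 5 3 = 0" using l[of 6 5 3] by (simp add: ev)
  have X553: "X 5 5 3 = - X 7 5 3" using l[of 5 5 3] by (simp add: ev)
  have X663: "X 6 6 3 = X 7 5 3" using l[of 6 6 3] by (simp add: ev)
  have X531: "X 5 3 1 = - X 7 5 3" using r[of 5 3 1] X575 X563 X553 by (simp add: ev)
  have X541: "X 5 4 1 = 0" using r[of 5 4 1] by (simp add: ev)
  have X751: "X 7 5 1 = 0" using r[of 7 5 1] by (simp add: ev)
  \<comment> \<open>The left relation at 5 forces opposite entries at \<open>(5, 3)\<close> and
    \<open>(5, 4)\<close>, up to \<open>X 7 5 1\<close>. Since 4 is not above 1,
    \<open>X 5 4 1\<close> is zero, whereas \<open>X 5 3 1\<close> is minus the overlap coefficient
    \<open>X 7 5 3\<close>; so the overlap dies here.\<close>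
  have X753: "X 7 5 3 = 0" using l[of 5 4 1] X531 X541 X751 by (simp add: ev)
  have "X 7 5 c = 0" using r[of 7 5 c] X775 X753 by (simp add: ev)
  moreover have "X 5 3 c = 0" using r[of 5 3 c] X575 X553 X563 X753 by (simp add: ev)
  moreover have "X 6 3 c = 0" using r[of 6 3 c] X675 X653 X663 X753 by (simp add: ev)
  ultimately show ?thesis using l[of a b c] by simp
qed

section \<open>Chains of bidegree (3, 3)\<close>

lemma Bas_3_3_iff: "t \<in> Bas E 3 3 \<longleftrightarrow> (\<exists>a\<in>E. \<exists>b\<in>E. \<exists>c\<in>E. t = [[a], [b], [c]])"
proof
  assume t: "t \<in> Bas E 3 3"
  then have "length t = 3" by (simp add: Bas_def)
  then obtain u v w where uvw: "t = [u, v, w]"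
    by (auto simp: numeral_3_eq_3 length_Suc_conv)
  with t have "u \<noteq> []" "v \<noteq> []" "w \<noteq> []" "length u + length v + length w = 3"
    by (auto simp: Bas_def)
  then have "length u = 1" "length v = 1" "length w = 1"
    by (cases u; cases v; cases w; simp)+
  then obtain a b c where "u = [a]" "v = [b]" "w = [c]"
    by (auto simp: length_Suc_conv)
  with t uvw show "\<exists>a\<in>E. \<exists>b\<in>E. \<exists>c\<in>E. t = [[a], [b], [c]]"
    by (auto simp: Bas_def)
qed (auto simp: Bas_def)

lemma Bas_3_3: "Bas E 3 3 = (\<lambda>(a, b, c). [[a], [b], [c]]) ` (E \<times> E \<times> E)"
  by (rule set_eqI) (simp add: Bas_3_3_iff image_iff Bex_def split_paired_Ex)

lemma Bas_4_3: "Bas E 4 3 = {}"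
proof -
  have "length t \<le> sum_list (map length t)" if "\<forall>w\<in>set t. w \<noteq> []" for t :: tuple
    using that
  proof (induction t)
    case (Cons w t)
    then show ?case by (cases w) auto
  qed simp
  then show ?thesis by (fastforce simp: Bas_def)
qed

lemma sum_Bas_3_3: "(\<Sum>t\<in>Bas E 3 3. F t) = (\<Sum>a\<in>E. \<Sum>b\<in>E. \<Sum>c\<in>E. F [[a], [b], [c]])"
proof -
  have "inj_on (\<lambda>(a, b, c). [[a], [b], [c]]) (E \<times> E \<times> E)"
    by (auto simp: inj_on_def)
  then show ?thesis
    unfolding Bas_3_3 by (simp add: sum.reindex sum.cartesian_product case_prod_unfold)
qed

lemma bar_d_delta_3:
  "bar_d (delta [[a], [b], [c]]) = (delta [[a], [b, c]] - delta [[a, b], [c]] :: tuple \<Rightarrow> 'k::field)"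
proof
  fix s :: tuple
  have "{1..<length [[a], [b], [c]]} = {1, 2}" by auto
  then show "bar_d (delta [[a], [b], [c]]) s = (delta [[a], [b, c]] - delta [[a, b], [c]] :: tuple \<Rightarrow> 'k) s"
    unfolding bar_d_delta by (auto simp: merge_def delta_apply numeral_2_eq_2)
qed

text \<open>The word lengths show which two letters were merged, so nothing cancels: the
  coefficients of \<open>bar_d x\<close> of either shape recover \<open>x\<close> up to
  sign.\<close>

lemma bar_d_3_3:
  assumes "x \<in> BarV E 3 3" "finite E" "a \<in> E" "b \<in> E" "c \<in> E"
  shows "bar_d x [[a, b], [c]] = - (x [[a], [b], [c]] :: 'k::field)"
    and "bar_d x [[a], [b, c]] = (x [[a], [b], [c]] :: 'k::field)"
proof -
  have x: "x t = 0" if "t \<notin> Bas E 3 3" for t using assms(1,2) that by (simp add: BarV_eq)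
  have "bar_d x s = (\<Sum>t\<in>Bas E 3 3. x t * bar_d (delta t) s)" for s
    by (subst bar_d_expand[OF finite_Bas[OF assms(2)] x]) (simp_all add: sum_fun_apply)
  moreover have "(\<Sum>t\<in>Bas E 3 3. x t * bar_d (delta t) s) = x [[a], [b], [c]] * bar_d (delta [[a], [b], [c]]) s"
    if "s = [[a, b], [c]] \<or> s = [[a], [b, c]]" for s
  proof -
    have "[[a], [b], [c]] \<in> Bas E 3 3" using assms(3-5) by (simp add: Bas_3_3_iff)
    moreover have "bar_d (delta t) s = (0 :: 'k)" if "t \<in> Bas E 3 3" "t \<noteq> [[a], [b], [c]]" for t
      using that \<open>s = _ \<or> s = _\<close> by (auto simp: Bas_3_3_iff bar_d_delta_3 delta_apply split: if_splits)
    ultimately show ?thesis using finite_Bas[OF assms(2), of 3 3]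
      by (subst sum.remove[of _ "[[a], [b], [c]]"]) (auto intro!: sum.neutral)
  qed
  ultimately show "bar_d x [[a, b], [c]] = - (x [[a], [b], [c]])"
    "bar_d x [[a], [b, c]] = x [[a], [b], [c]]"
    by (simp_all add: bar_d_delta_3 delta_apply)
qed

section \<open>Pure tensors and the kernel of the quotient map\<close>

lemma tens_2: "tens [f, g] [u, v] = f u * g v"
  by (simp add: tens_def numeral_2_eq_2)

lemma tens_3: "tens [f, g, h] [u, v, w] = f u * g v * h w"
  by (simp add: tens_def numeral_3_eq_3)

lemma tens_length: "length t \<noteq> length fs \<Longrightarrow> tens fs t = 0"
  by (simp add: tens_def)

lemma tens_3_eqI:
  assumes "\<And>u v w. F [u, v, w] = G [u, v, w]" "\<And>t. length t \<noteq> 3 \<Longrightarrow> F t = G t"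
  shows "F = G"
proof
  fix t :: "'a list" show "F t = G t"
  proof (cases "length t = 3")
    case True
    then obtain u v w where "t = [u, v, w]" by (auto simp: numeral_3_eq_3 length_Suc_conv)
    then show ?thesis using assms(1) by simp
  qed (rule assms(2))
qed

lemma tens_2_eqI:
  assumes "\<And>u v. F [u, v] = G [u, v]" "\<And>t. length t \<noteq> 2 \<Longrightarrow> F t = G t"
  shows "F = G"
proof
  fix t :: "'a list" show "F t = G t"
  proof (cases "length t = 2")
    case True
    then obtain u v where "t = [u, v]" by (auto simp: numeral_2_eq_2 length_Suc_conv)
    then show ?thesis using assms(1) by simp
  qed (rule assms(2))
qed

text \<open>This is \<open>BarK\<close> before the restriction to one internal degree, so that pure
  tensors of inhomogeneous elements can be treated one by one.\<close>

definition TensK :: "edge set \<Rightarrow> (word \<Rightarrow> 'k::field) set \<Rightarrow> nat \<Rightarrow> (tuple \<Rightarrow> 'k) set" where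
  "TensK E J i = fspan {tens fs | fs. length fs = i \<and> (\<forall>f\<in>set fs. f \<in> Tpos E) \<and> (\<exists>f\<in>set fs. f \<in> J)}"

lemma BarK_TensK: "BarK E J i j = TensK E J i \<inter> Deg j"
  by (simp add: BarK_def TensK_def)

lemma TensK_I:
  "length fs = i \<Longrightarrow> \<forall>f\<in>set fs. f \<in> Tpos E \<Longrightarrow> \<exists>f\<in>set fs. f \<in> J \<Longrightarrow> tens fs \<in> TensK E J i"
  unfolding TensK_def by (rule fs.span_base) auto

lemma TensK_minimal:
  assumes "fs.subspace S"
    and "\<And>fs. length fs = i \<Longrightarrow> \<forall>f\<in>set fs. f \<in> Tpos E \<Longrightarrow> \<exists>f\<in>set fs. f \<in> J \<Longrightarrow> tens fs \<in> S"
    and "z \<in> TensK E J i"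
  shows "z \<in> S"
proof (rule subsetD[OF fs.span_minimal[OF _ assms(1)] assms(3)[unfolded TensK_def]])
  show "{tens fs | fs. length fs = i \<and> (\<forall>f\<in>set fs. f \<in> Tpos E) \<and> (\<exists>f\<in>set fs. f \<in> J)} \<subseteq> S"
    using assms(2) by auto
qed

lemma subspace_TensK: "fs.subspace (TensK E J i)"
  unfolding TensK_def by (rule fs.subspace_span)

lemma BarV_Deg: "finite E \<Longrightarrow> BarV E i j \<subseteq> (Deg j :: (tuple \<Rightarrow> 'k::field) set)"
  by (auto simp: BarV_eq Deg_def Bas_def)

lemma delta_Tpos: "w \<noteq> [] \<Longrightarrow> set w \<subseteq> E \<Longrightarrow> delta w \<in> Tpos E"
  unfolding Tpos_def by (rule fs.span_base) auto

lemma subspace_Tpos: "fs.subspace (Tpos E)"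
  unfolding Tpos_def by (rule fs.subspace_span)

lemma sum3_product:
  fixes A B C :: "'a \<Rightarrow> 'k::field"
  shows "(\<Sum>p\<in>P. A p) * (\<Sum>q\<in>P. B q) * (\<Sum>r\<in>P. C r) = (\<Sum>p\<in>P. \<Sum>q\<in>P. \<Sum>r\<in>P. A p * B q * C r)"
  unfolding sum_product[of A P B P] by (simp only: sum_distrib_right) (simp only: sum_distrib_left)

lemma sum3_swap:
  "(\<Sum>a\<in>A. \<Sum>b\<in>A. \<Sum>c\<in>A. \<Sum>p\<in>P. \<Sum>q\<in>P. \<Sum>r\<in>P. F a b c p q r)
    = (\<Sum>p\<in>P. \<Sum>q\<in>P. \<Sum>r\<in>P. \<Sum>a\<in>A. \<Sum>b\<in>A. \<Sum>c\<in>A. F a b c p q r)"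
proof -
  have "(\<Sum>x\<in>A\<times>A\<times>A. \<Sum>y\<in>P\<times>P\<times>P. F (fst x) (fst (snd x)) (snd (snd x)) (fst y) (fst (snd y)) (snd (snd y)))
     = (\<Sum>y\<in>P\<times>P\<times>P. \<Sum>x\<in>A\<times>A\<times>A. F (fst x) (fst (snd x)) (snd (snd x)) (fst y) (fst (snd y)) (snd (snd y)))"
    by (rule sum.swap)
  then show ?thesis
    by (simp add: sum.cartesian_product' case_prod_unfold)
qed

section \<open>A lift of the degree one part\<close>

text \<open>The edges on the path to 0 that underlies \<open>pot\<close>, summed: a representative
  in the free algebra of the basis vector at \<open>x\<close>.\<close>

definition lift :: "nat \<Rightarrow> word \<Rightarrow> 'k::field" where
  "lift x =
    (if x = 1 then delta [(1,0)]
     else if x = 2 then delta [(2,0)]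
     else if x = 3 then delta [(3,1)] + delta [(1,0)]
     else if x = 4 then delta [(4,2)] + delta [(2,0)]
     else if x = 5 then delta [(5,3)] + delta [(3,1)] + delta [(1,0)]
     else if x = 6 then delta [(6,3)] + delta [(3,1)] + delta [(1,0)]
     else if x = 7 then delta [(7,5)] + delta [(5,3)] + delta [(3,1)] + delta [(1,0)]
     else 0)"

definition norm1 :: "edge \<Rightarrow> word \<Rightarrow> 'k::field" where
  "norm1 e = lift (fst e) - lift (snd e)"

lemma lift_Tpos: "lift x \<in> Tpos E8"
proof -
  have "delta [e] \<in> Tpos E8" if "e \<in> E8" for e using that by (intro delta_Tpos) auto
  moreover have "lift x = 0 \<or> x \<in> {1,2,3,4,5,6,7}" by (auto simp: lift_def)
  ultimately show ?thesis
    by (elim disjE)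
      (auto simp: lift_def E8_def fs.subspace_0[OF subspace_Tpos] intro!: fs.subspace_add[OF subspace_Tpos])
qed

lemma norm1_Tpos: "norm1 e \<in> Tpos E8"
  unfolding norm1_def by (intro fs.subspace_diff[OF subspace_Tpos] lift_Tpos)

lemma gens_V8I:
  assumes "is_path V8 le8 0 b a p" "is_path V8 le8 0 b a q" "a \<in> V8" "b \<in> V8" "lt le8 a b" "j \<le> length (path_edges p)"
  shows "esym (path_edges p) j - esym (path_edges q) j \<in> G8"
  unfolding gens_def using assms by blast

lemmas path_V8_simps = is_path_Cons is_path_singleton covers_V8 E8_def

lemma paths_V8:
  "is_path V8 le8 0 5 0 [5,3,1,0]" "is_path V8 le8 0 5 0 [5,4,2,0]"
  "is_path V8 le8 0 6 0 [6,3,1,0]" "is_path V8 le8 0 6 0 [6,4,2,0]"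
  "is_path V8 le8 0 7 3 [7,5,3]" "is_path V8 le8 0 7 3 [7,6,3]"
  by (simp_all add: path_V8_simps)

lemma lt_V8: "lt le8 0 5" "lt le8 0 6" "lt le8 3 7"
  by (simp_all add: lt_def le8_def rank8_def)

lemma linear_gens:
  "delta [(5,3)] + delta [(3,1)] + delta [(1,0)] - (delta [(5,4)] + delta [(4,2)] + delta [(2,0)]) \<in> fspan G8"
  "delta [(6,3)] + delta [(3,1)] + delta [(1,0)] - (delta [(6,4)] + delta [(4,2)] + delta [(2,0)]) \<in> fspan G8"
  "delta [(7,5)] + delta [(5,3)] - (delta [(7,6)] + delta [(6,3)]) \<in> fspan G8"
proof -
  note ev = path_edges_Cons path_edges_singleton esym_Cons
  \<comment> \<open>In degree one \<open>esym\<close> is minus the sum of the edges, hence the outer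
    sign.\<close>
  have "- (esym (path_edges [5,3,1,0]) (Suc 0) - esym (path_edges [5,4,2,0]) (Suc 0)) \<in> fspan G8"
    by (intro fs.span_neg fs.span_base gens_V8I[OF paths_V8(1,2)]) (simp_all add: lt_V8 V8_def path_edges_def)
  then show "delta [(5,3)] + delta [(3,1)] + delta [(1,0)] - (delta [(5,4)] + delta [(4,2)] + delta [(2,0)]) \<in> fspan G8"
    by (simp add: ev algebra_simps)
  have "- (esym (path_edges [6,3,1,0]) (Suc 0) - esym (path_edges [6,4,2,0]) (Suc 0)) \<in> fspan G8"
    by (intro fs.span_neg fs.span_base gens_V8I[OF paths_V8(3,4)]) (simp_all add: lt_V8 V8_def path_edges_def)
  then show "delta [(6,3)] + delta [(3,1)] + delta [(1,0)] - (delta [(6,4)] + delta [(4,2)] + delta [(2,0)]) \<in> fspan G8"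
    by (simp add: ev algebra_simps)
  have "- (esym (path_edges [7,5,3]) (Suc 0) - esym (path_edges [7,6,3]) (Suc 0)) \<in> fspan G8"
    by (intro fs.span_neg fs.span_base gens_V8I[OF paths_V8(5,6)]) (simp_all add: lt_V8 V8_def path_edges_def)
  then show "delta [(7,5)] + delta [(5,3)] - (delta [(7,6)] + delta [(6,3)]) \<in> fspan G8"
    by (simp add: ev algebra_simps)
qed

lemma quadratic_gens:
  "delta [(5,3),(3,1)] + delta [(5,3),(1,0)] + delta [(3,1),(1,0)]
    - (delta [(5,4),(4,2)] + delta [(5,4),(2,0)] + delta [(4,2),(2,0)]) \<in> fspan G8"
  "delta [(6,3),(3,1)] + delta [(6,3),(1,0)] + delta [(3,1),(1,0)]
    - (delta [(6,4),(4,2)] + delta [(6,4),(2,0)] + delta [(4,2),(2,0)]) \<in> fspan G8"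
  "delta [(7,5),(5,3)] - delta [(7,6),(6,3)] \<in> fspan G8"
proof -
  note ev = path_edges_Cons path_edges_singleton esym_Cons
  have "(esym (path_edges [5,3,1,0]) (Suc (Suc 0)) - esym (path_edges [5,4,2,0]) (Suc (Suc 0))) \<in> fspan G8"
    by (intro fs.span_base gens_V8I[OF paths_V8(1,2)]) (simp_all add: lt_V8 V8_def path_edges_def)
  then show "delta [(5,3),(3,1)] + delta [(5,3),(1,0)] + delta [(3,1),(1,0)]
    - (delta [(5,4),(4,2)] + delta [(5,4),(2,0)] + delta [(4,2),(2,0)]) \<in> fspan G8"
    by (simp add: ev algebra_simps)
  have "(esym (path_edges [6,3,1,0]) (Suc (Suc 0)) - esym (path_edges [6,4,2,0]) (Suc (Suc 0))) \<in> fspan G8"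
    by (intro fs.span_base gens_V8I[OF paths_V8(3,4)]) (simp_all add: lt_V8 V8_def path_edges_def)
  then show "delta [(6,3),(3,1)] + delta [(6,3),(1,0)] + delta [(3,1),(1,0)]
    - (delta [(6,4),(4,2)] + delta [(6,4),(2,0)] + delta [(4,2),(2,0)]) \<in> fspan G8"
    by (simp add: ev algebra_simps)
  have "(esym (path_edges [7,5,3]) (Suc (Suc 0)) - esym (path_edges [7,6,3]) (Suc (Suc 0))) \<in> fspan G8"
    by (intro fs.span_base gens_V8I[OF paths_V8(5,6)]) (simp_all add: lt_V8 V8_def path_edges_def)
  then show "delta [(7,5),(5,3)] - delta [(7,6),(6,3)] \<in> fspan G8"
    by (simp add: ev algebra_simps)
qed

text \<open>\<open>norm1\<close> is a normal form modulo the linear relations. Edges on chosen paths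
  are their own normal form; each of the other three differs from it by one linear relation.\<close>

lemma norm1_congruent:
  assumes "e \<in> E8" shows "delta [e] - norm1 e \<in> fspan (G8 :: (word \<Rightarrow> 'k::field) set)"
proof -
  from assms consider "delta [e] - norm1 e = (0 :: word \<Rightarrow> 'k)" | "e \<in> {(5,4), (6,4), (7,6)}"
    by (auto simp: E8_def norm1_def lift_def)
  then show "delta [e] - norm1 e \<in> fspan (G8 :: (word \<Rightarrow> 'k) set)"
  proof cases
    case 1
    then show ?thesis by (simp add: fs.span_zero)
  next
    case 2
    then consider "e = (5,4)" | "e = (6,4)" | "e = (7,6)" by auto
    then show ?thesis
    proof cases
      case 1
      then show ?thesis using fs.span_neg[OF linear_gens(1)] by (simp add: norm1_def lift_def algebra_simps)
    next
      case 2
      then show ?thesis using fs.span_neg[OF linear_gens(2)] by (simp add: norm1_def lift_def algebra_simps)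
    next
      case 3
      then show ?thesis using fs.span_neg[OF linear_gens(3)] by (simp add: norm1_def lift_def algebra_simps)
    qed
  qed
qed

lemma sandwich_span_gens:
  assumes "f \<in> fspan (G8 :: (word \<Rightarrow> 'k::field) set)" "set u \<subseteq> E8" "set v \<subseteq> E8"
  shows "sandwich u f v \<in> I8"
proof -
  have "fs.subspace {f :: word \<Rightarrow> 'k. sandwich u f v \<in> I8}"
  proof (rule fs.subspaceI)
    have "sandwich u (fsc c f) v = fsc c (sandwich u f v)" for c and f :: "word \<Rightarrow> 'k"
      by (auto simp: sandwich_def fun_eq_iff)
    then show "fsc c f \<in> {f. sandwich u f v \<in> I8}" if "f \<in> {f :: word \<Rightarrow> 'k. sandwich u f v \<in> I8}" for c f
      using that by (auto simp: idealI_def intro: fs.span_scale)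
  qed (auto simp: idealI_def intro: fs.span_zero fs.span_add)
  moreover have "G8 \<subseteq> {f :: word \<Rightarrow> 'k. sandwich u f v \<in> I8}"
    unfolding idealI_def Edges_V8 using assms(2,3) by (auto intro!: fs.span_base)
  ultimately show ?thesis using fs.span_minimal assms(1) by blast
qed

lemma span_gens_ideal: "f \<in> fspan G8 \<Longrightarrow> f \<in> I8"
  using sandwich_span_gens[of f "[]" "[]"] by simp

section \<open>Vanishing for the splitting algebra\<close>

lemma norm1_chi:
  assumes "e \<in> E8"
  shows "norm1 e w = (\<Sum>p\<in>{1..7}. (chi p (fst e) - chi p (snd e)) * (lift p w :: 'k::field))"
proof -
  have l: "(\<Sum>p\<in>{1..7}. chi p x * (lift p w :: 'k)) = lift x w" if "x \<le> 7" for x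
  proof -
    have "(\<Sum>p\<in>{1..7}. chi p x * (lift p w :: 'k)) = (\<Sum>p\<in>{1..7}. if p = x then lift x w else 0)"
      by (intro sum.cong) (auto simp: chi_def)
    also have "\<dots> = lift x w"
      using that by (cases "x = 0") (auto simp: lift_def)
    finally show ?thesis .
  qed
  have "fst e \<le> 7" "snd e \<le> 7" using assms by (auto simp: E8_def)
  then show ?thesis by (simp add: norm1_def left_diff_distrib sum_subtractf l[simplified])
qed

text \<open>The image of a chain in the third tensor power of \<open>V\<close>, in
  coordinates.\<close>

definition coord :: "(edge \<Rightarrow> edge \<Rightarrow> edge \<Rightarrow> 'k::field) \<Rightarrow> nat \<Rightarrow> nat \<Rightarrow> nat \<Rightarrow> 'k" where
  "coord k p q r = (\<Sum>a\<in>E8. \<Sum>b\<in>E8. \<Sum>c\<in>E8.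
    (chi p (fst a) - chi p (snd a)) * (chi q (fst b) - chi q (snd b)) * (chi r (fst c) - chi r (snd c)) * k a b c)"

lemma coord_zero [simp]: "coord (\<lambda>a b c. 0) p = (\<lambda>q r. 0)"
  by (simp add: coord_def fun_eq_iff)

lemma coord_add: "coord (\<lambda>a b c. k a b c + k' a b c) p = (\<lambda>q r. coord k p q r + coord k' p q r)"
  by (simp add: coord_def distrib_left sum.distrib fun_eq_iff)

lemma coord_scale: "coord (\<lambda>a b c. s * k a b c) p = (\<lambda>q r. s * coord k p q r)"
  by (simp add: coord_def sum_distrib_left mult_ac fun_eq_iff)

lemma coord_split_left:
  "coord (\<lambda>a b c. f [a, b] * g [c]) p = (\<lambda>q r. quad (chi p) (chi q) f * lin (chi r) g)"
  unfolding fun_eq_iff coord_def quad_def lin_def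
  by (simp only: sum_distrib_right) (simp add: sum_distrib_left mult_ac)

lemma coord_split_right:
  "coord (\<lambda>a b c. f [a] * g [b, c]) p = (\<lambda>q r. lin (chi p) f * quad (chi q) (chi r) g)"
  unfolding fun_eq_iff coord_def quad_def lin_def
  by (simp only: sum_distrib_right) (simp add: sum_distrib_left mult_ac)

text \<open>On words of lengths two and one, a pure tensor of \<open>f\<close> and \<open>g\<close>
  has coordinates \<open>quad\<close> of \<open>f\<close> times \<open>lin\<close> of
  \<open>g\<close>. If \<open>f\<close> is in the ideal the first factor lies in \<open>R8\<close>;
  if \<open>g\<close> is, the second is zero. The other shape is symmetric.\<close>

lemma TensK_coord:
  assumes "k \<in> TensK E8 (I8 :: (word \<Rightarrow> 'k::field) set) 2"
  shows "(\<lambda>p q. coord (\<lambda>a b c. k [[a, b], [c]]) p q r) \<in> R8"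
    and "(\<lambda>q r. coord (\<lambda>a b c. k [[a], [b, c]]) p q r) \<in> R8"
proof -
  let ?S = "{k :: tuple \<Rightarrow> 'k. (\<forall>r. (\<lambda>p q. coord (\<lambda>a b c. k [[a, b], [c]]) p q r) \<in> R8)
    \<and> (\<forall>p. (\<lambda>q r. coord (\<lambda>a b c. k [[a], [b, c]]) p q r) \<in> R8)}"
  have "k \<in> ?S"
  proof (rule TensK_minimal[OF _ _ assms])
    show "fs.subspace ?S"
      by (rule fs.subspaceI) (auto simp: coord_add coord_scale R8_add R8_scale)
    fix fs :: "(word \<Rightarrow> 'k) list" assume "length fs = 2" and I: "\<exists>f\<in>set fs. f \<in> I8"
    then obtain f g where fg: "fs = [f, g]" by (auto simp: numeral_2_eq_2 length_Suc_conv)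
    have "(\<lambda>p q. quad (chi p) (chi q) f * lin (chi r) g) \<in> R8" "(\<lambda>p q. lin (chi r) f * quad (chi p) (chi q) g) \<in> R8" for r
      using I ideal_props[of f] ideal_props[of g] fg R8_scale[of "\<lambda>p q. quad (chi p) (chi q) f" "lin (chi r) g"]
        R8_scale[of "\<lambda>p q. quad (chi p) (chi q) g" "lin (chi r) f"]
      by (auto simp: mult.commute)
    then show "tens fs \<in> ?S"
      by (simp add: fg tens_2 coord_split_left coord_split_right)
  qed
  then show "(\<lambda>p q. coord (\<lambda>a b c. k [[a, b], [c]]) p q r) \<in> R8"
    "(\<lambda>q r. coord (\<lambda>a b c. k [[a], [b, c]]) p q r) \<in> R8" by auto
qed

lemma chain_expand_3_3:
  assumes "x \<in> BarV E 3 3" "finite E"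
  shows "x = (\<Sum>a\<in>E. \<Sum>b\<in>E. \<Sum>c\<in>E. fsc (x [[a], [b], [c]]) (delta [[a], [b], [c]]))"
proof -
  have "x = (\<Sum>t\<in>Bas E 3 3. fsc (x t) (delta t))"
    using assms by (subst sum_fsc_delta) (auto simp: finite_Bas BarV_eq)
  then show ?thesis by (simp add: sum_Bas_3_3)
qed

text \<open>The two shapes of words in the differential put the coordinates of a cycle into both
  \<open>R \<otimes> V\<close> and \<open>V \<otimes> R\<close>, so they vanish. A chain with
  vanishing coordinates lies in the kernel, as replacing edges by normal forms shows.\<close>

lemma TorZ_subset_TorB: "TorZ E8 (I8 :: (word \<Rightarrow> 'k::field) set) 3 3 \<subseteq> TorB E8 I8 3 3"
proof
  fix x :: "tuple \<Rightarrow> 'k" assume x: "x \<in> TorZ E8 I8 3 3"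
  then have xV: "x \<in> BarV E8 3 3" and K: "bar_d x \<in> TensK E8 I8 2"
    by (auto simp: TorZ_def BarK_TensK)
  define X where "X = coord (\<lambda>a b c. x [[a], [b], [c]])"
  have "coord (\<lambda>a b c. bar_d x [[a], [b, c]]) = X"
    unfolding X_def coord_def fun_eq_iff using bar_d_3_3[OF xV] by simp
  then have right: "(\<lambda>q r. X p q r) \<in> R8" for p
    using TensK_coord(2)[OF K] by simp
  have "(\<lambda>p q. coord (\<lambda>a b c. bar_d x [[a, b], [c]]) p q r) = (\<lambda>p q. -1 * X p q r)" for r
    unfolding X_def coord_def fun_eq_iff using bar_d_3_3[OF xV] by (simp add: sum_negf)
  then have "(\<lambda>p q. -1 * X p q r) \<in> R8" for r
    using TensK_coord(1)[OF K, of r] by simp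
  from R8_scale[OF this, of "-1"] have left: "(\<lambda>p q. X p q r) \<in> R8" for r by simp
  have X0: "X p q r = 0" for p q r by (rule R8_overlap[OF left right])
  \<comment> \<open>Edges are replaced by normal forms one factor at a time, which keeps each error
    in the kernel.\<close>
  define D where "D a b c = delta [[a], [b], [c]] - (tens [norm1 a, norm1 b, norm1 c] :: tuple \<Rightarrow> 'k)" for a b c
  have D: "D a b c \<in> TensK E8 I8 3" if "a \<in> E8" "b \<in> E8" "c \<in> E8" for a b c
  proof -
    have "D a b c = tens [delta [a] - norm1 a, delta [b], delta [c]]
        + (tens [norm1 a, delta [b] - norm1 b, delta [c]] + tens [norm1 a, norm1 b, delta [c] - norm1 c])"
    proof (rule tens_3_eqI)
      show "D a b c [u, v, w] = (tens [delta [a] - norm1 a, delta [b], delta [c]]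
        + (tens [norm1 a, delta [b] - norm1 b, delta [c]] + tens [norm1 a, norm1 b, delta [c] - norm1 c])) [u, v, w]" for u v w
        by (simp add: D_def tens_3 delta_apply algebra_simps)
    qed (auto simp: D_def tens_length delta_apply)
    moreover have T: "delta [e] \<in> (Tpos E8 :: (word \<Rightarrow> 'k) set)"
      "delta [e] - norm1 e \<in> (Tpos E8 :: (word \<Rightarrow> 'k) set)" "delta [e] - norm1 e \<in> (I8 :: (word \<Rightarrow> 'k) set)" if "e \<in> E8" for e
      using that by (auto intro!: delta_Tpos fs.subspace_diff[OF subspace_Tpos] norm1_Tpos span_gens_ideal norm1_congruent)
    ultimately show ?thesis
      using T[OF that(1)] T[OF that(2)] T[OF that(3)]
      by (auto intro!: fs.subspace_add[OF subspace_TensK] TensK_I norm1_Tpos)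
  qed
  have n3: "norm1 a u * norm1 b v * norm1 c w = (\<Sum>p\<in>{1..7}. \<Sum>q\<in>{1..7}. \<Sum>r\<in>{1..7}.
      (chi p (fst a) - chi p (snd a)) * lift p u * ((chi q (fst b) - chi q (snd b)) * lift q v)
        * ((chi r (fst c) - chi r (snd c)) * (lift r w :: 'k)))"
    if "a \<in> E8" "b \<in> E8" "c \<in> E8" for a b c u v w
    by (simp only: norm1_chi[OF that(1)] norm1_chi[OF that(2)] norm1_chi[OF that(3)] sum3_product)
  \<comment> \<open>What is left after the replacement is a function of the coordinates
    \<open>X\<close> alone.\<close>
  have N: "(\<Sum>a\<in>E8. \<Sum>b\<in>E8. \<Sum>c\<in>E8. x [[a], [b], [c]] * (norm1 a u * norm1 b v * norm1 c w)) = 0" for u v w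
  proof -
    have "(\<Sum>a\<in>E8. \<Sum>b\<in>E8. \<Sum>c\<in>E8. x [[a], [b], [c]] * (norm1 a u * norm1 b v * norm1 c w))
      = (\<Sum>a\<in>E8. \<Sum>b\<in>E8. \<Sum>c\<in>E8. \<Sum>p\<in>{1..7}. \<Sum>q\<in>{1..7}. \<Sum>r\<in>{1..7}.
          ((chi p (fst a) - chi p (snd a)) * (chi q (fst b) - chi q (snd b)) * (chi r (fst c) - chi r (snd c))
            * x [[a], [b], [c]]) * (lift p u * lift q v * lift r w))"
      by (intro sum.cong refl, simp only: n3 sum_distrib_left) (simp add: mult_ac)
    also have "\<dots> = (\<Sum>p\<in>{1..7}. \<Sum>q\<in>{1..7}. \<Sum>r\<in>{1..7}. X p q r * (lift p u * lift q v * lift r w))"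
      by (subst sum3_swap) (simp only: X_def coord_def sum_distrib_right)
    finally show ?thesis by (simp add: X0)
  qed
  have "x = (\<Sum>a\<in>E8. \<Sum>b\<in>E8. \<Sum>c\<in>E8. fsc (x [[a], [b], [c]]) (D a b c))"
  proof (rule tens_3_eqI)
    fix u v w
    have "x [u, v, w] = (\<Sum>a\<in>E8. \<Sum>b\<in>E8. \<Sum>c\<in>E8. fsc (x [[a], [b], [c]]) (delta [[a], [b], [c]])) [u, v, w]"
      using chain_expand_3_3[OF xV] by simp
    then show "x [u, v, w] = (\<Sum>a\<in>E8. \<Sum>b\<in>E8. \<Sum>c\<in>E8. fsc (x [[a], [b], [c]]) (D a b c)) [u, v, w]"
      using N[of u v w] by (simp add: sum_fun_apply D_def tens_3 right_diff_distrib sum_subtractf)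
  next
    fix t :: tuple assume "length t \<noteq> 3"
    then have "D a b c t = 0" for a b c by (auto simp: D_def tens_length delta_apply)
    moreover have "x t = 0" using xV \<open>length t \<noteq> 3\<close> by (auto simp: BarV_eq Bas_def)
    ultimately show "x t = (\<Sum>a\<in>E8. \<Sum>b\<in>E8. \<Sum>c\<in>E8. fsc (x [[a], [b], [c]]) (D a b c)) t"
      by (simp add: sum_fun_apply)
  qed
  moreover have "(\<Sum>a\<in>E8. \<Sum>b\<in>E8. \<Sum>c\<in>E8. fsc (x [[a], [b], [c]]) (D a b c)) \<in> TensK E8 I8 3"
    by (intro fs.subspace_sum[OF subspace_TensK] fs.subspace_scale[OF subspace_TensK] D)
  ultimately have "x \<in> BarK E8 I8 3 3"
    using xV BarV_Deg[of E8 3 3] by (auto simp: BarK_TensK)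
  then show "x \<in> TorB E8 I8 3 3"
    unfolding TorB_def by (intro fs.span_base) simp
qed

section \<open>Nonvanishing for the associated graded algebra\<close>

abbreviation W8 :: "nat \<Rightarrow> (word \<Rightarrow> 'k::field) set" where "W8 n \<equiv> WtH V8 le8 0 n"
abbreviation F8 :: "nat \<Rightarrow> (word \<Rightarrow> 'k::field) set" where "F8 n \<equiv> FTlt V8 le8 0 n"

lemma rank8_E8: "e \<in> E8 \<Longrightarrow> rank8 (snd e) < rank8 (fst e)"
  by (auto simp: E8_def rank8_def)

lemma delta_W8: "set w \<subseteq> E8 \<Longrightarrow> wt8 w = n \<Longrightarrow> delta w \<in> W8 n"
  unfolding WtH_def Edges_V8 by (rule fs.span_base) (use wt_V8 in auto)

lemma delta_F8: "set w \<subseteq> E8 \<Longrightarrow> wt8 w < n \<Longrightarrow> delta w \<in> F8 n"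
  unfolding FTlt_def Edges_V8 by (rule fs.span_base) (use wt_V8 in auto)

lemma W8_support:
  assumes "h \<in> (W8 n :: (word \<Rightarrow> 'k::field) set)" "h w \<noteq> 0"
  shows "wt8 w = n"
proof -
  have "W8 n \<subseteq> {h :: word \<Rightarrow> 'k. \<forall>w. h w \<noteq> 0 \<longrightarrow> wt8 w = n}"
    unfolding WtH_def Edges_V8
    by (rule fs.span_minimal[OF _ subspace_support]) (auto simp: delta_apply wt_V8 split: if_splits)
  with assms show ?thesis by auto
qed

lemma subspace_L8: "fs.subspace L8"
  unfolding leadI_def by (rule fs.subspace_span)

lemma L8_I:
  assumes "h \<in> W8 n" "i \<in> I8" "l \<in> F8 n" "h = i + l"
  shows "h \<in> L8"
proof -
  have "i + l \<in> fspan (I8 \<union> F8 n)"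
    using assms(2,3) by (intro fs.span_add fs.span_base) auto
  with assms(1,4) show ?thesis unfolding leadI_def by (intro fs.span_base) auto
qed

text \<open>An edge has coordinate 1 at its source and 0 at all other vertices of the same or higher rank, so up to lower
  weight the coordinates of an edge only see its source.\<close>
lemma lead_fiber:
  assumes "f \<in> (L8 :: (word \<Rightarrow> 'k::field) set)"
  shows "(\<Sum>e\<in>E8. G (fst e) * f [e]) = 0"
proof -
  have "L8 \<subseteq> {f :: word \<Rightarrow> 'k. (\<Sum>e\<in>E8. G (fst e) * f [e]) = 0}"
    unfolding leadI_def
  proof (rule fs.span_minimal)
    show "fs.subspace {f :: word \<Rightarrow> 'k. (\<Sum>e\<in>E8. G (fst e) * f [e]) = 0}"
      by (rule subspace_functional_kernel, rule functionalI)
        (simp_all add: distrib_left sum.distrib sum_distrib_left mult_ac)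
    show "{h. \<exists>n. h \<in> W8 n \<and> h \<in> fspan (I8 \<union> F8 n)} \<subseteq> {f :: word \<Rightarrow> 'k. (\<Sum>e\<in>E8. G (fst e) * f [e]) = 0}"
    proof clarify
      fix h :: "word \<Rightarrow> 'k" and n assume W: "h \<in> W8 n" and h: "h \<in> fspan (I8 \<union> F8 n)"
      define H where "H s = (if rank8 s = n then G s else 0)" for s
      have ker: "fs.subspace {f. lin H f = 0}"
        by (rule subspace_functional_kernel, rule functionalI) auto
      have "lin H (delta w) = 0" if w: "set w \<subseteq> E8" "wt8 w < n" for w
        unfolding lin_def
      proof (intro sum.neutral ballI)
        fix e assume e: "e \<in> E8"
        show "(H (fst e) - H (snd e)) * delta w [e] = 0"
          using w(2) rank8_E8[OF e] by (auto simp: delta_apply H_def)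
      qed
      then have "F8 n \<subseteq> {f. lin H f = 0}"
        unfolding FTlt_def Edges_V8 by (intro fs.span_minimal[OF _ ker]) (auto simp: wt_V8)
      moreover have "I8 \<subseteq> {f. lin H f = 0}" using ideal_props(1) by auto
      ultimately have "lin H h = 0" using fs.span_minimal[OF _ ker] h by blast
      moreover have "lin H h = (\<Sum>e\<in>E8. G (fst e) * h [e])"
        unfolding lin_def
      proof (rule sum.cong)
        fix e assume e: "e \<in> E8"
        show "(H (fst e) - H (snd e)) * h [e] = G (fst e) * h [e]"
          using W8_support[OF W, of "[e]"] rank8_E8[OF e] by (cases "h [e] = 0") (auto simp: H_def)
      qed simp
      ultimately show "(\<Sum>e\<in>E8. G (fst e) * h [e]) = 0" by simp
    qed
  qed
  with assms show ?thesis by auto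
qed

text \<open>Every edge in \<open>lift y\<close> starts at a vertex of rank at most that of
  \<open>y\<close>.\<close>

lemma sandwich_lift_F8:
  assumes "set u \<subseteq> E8" "set v \<subseteq> E8" "wt8 u + rank8 y + wt8 v < n"
  shows "sandwich u (lift y) v \<in> (F8 n :: (word \<Rightarrow> 'k::field) set)"
proof -
  have F: "fs.subspace (F8 n :: (word \<Rightarrow> 'k) set)" unfolding FTlt_def by (rule fs.subspace_span)
  have d: "delta (u @ e # v) \<in> (F8 n :: (word \<Rightarrow> 'k) set)" if "e \<in> E8" "rank8 (fst e) \<le> rank8 y" for e
    using assms that by (intro delta_F8) auto
  consider "lift y = (0 :: word \<Rightarrow> 'k)" | "y \<in> {1,2,3,4,5,6,7}"
    by (cases "y \<in> {1,2,3,4,5,6,7}") (auto simp: lift_def)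
  then show ?thesis
  proof cases
    case 1
    then show ?thesis using fs.subspace_0[OF F] by simp
  next
    case 2
    then show ?thesis
      by (elim insertE emptyE)
        (simp_all add: lift_def, (intro fs.subspace_add[OF F] d; simp add: E8_def rank8_def)+)
  qed
qed

text \<open>Normal forms of edges with a common source share the \<open>lift\<close> of that source,
  and the rest has lower weight. In the associated graded algebra an edge is thus determined by its
  source.\<close>

lemma lead_swap:
  assumes "e \<in> E8" "e' \<in> E8" "fst e = fst e'" "set u \<subseteq> E8" "set v \<subseteq> E8"
  shows "delta (u @ e # v) - delta (u @ e' # v) \<in> L8"
proof (rule L8_I)
  let ?n = "wt8 u + rank8 (fst e) + wt8 v"
  show "delta (u @ e # v) - delta (u @ e' # v) \<in> W8 ?n"
    unfolding WtH_def by (intro fs.span_diff; fold WtH_def) (use assms in \<open>auto intro!: delta_W8\<close>)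
  show "sandwich u (delta [e] - norm1 e) v - sandwich u (delta [e'] - norm1 e') v \<in> I8"
    unfolding idealI_def by (intro fs.span_diff; fold idealI_def)
      (use assms in \<open>auto intro!: sandwich_span_gens norm1_congruent simp del: sandwich_diff\<close>)
  show "sandwich u (lift (snd e')) v - sandwich u (lift (snd e)) v \<in> F8 ?n"
    unfolding FTlt_def by (intro fs.span_diff; fold FTlt_def)
      (use assms rank8_E8[of e] rank8_E8[of e'] in \<open>auto intro!: sandwich_lift_F8\<close>)
  show "delta (u @ e # v) - delta (u @ e' # v)
    = sandwich u (delta [e] - norm1 e) v - sandwich u (delta [e'] - norm1 e') v
      + (sandwich u (lift (snd e')) v - sandwich u (lift (snd e)) v)"
    using assms(3) by (simp add: norm1_def algebra_simps)
qed

text \<open>The quadratic relation at 7 is homogeneous of weight 7 = 4 + 3, so it is its own leading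
  term; \<open>(7,6)\<close> is then exchanged for \<open>(7,5)\<close>.\<close>

lemma lead_75: "delta [(7,5),(5,3)] - delta [(7,5),(6,3)] \<in> (L8 :: (word \<Rightarrow> 'k::field) set)"
proof -
  have "delta [(7,5),(5,3)] - delta [(7,6),(6,3)] \<in> (L8 :: (word \<Rightarrow> 'k) set)"
  proof (rule L8_I[where n = 7])
    show "delta [(7,5),(5,3)] - delta [(7,6),(6,3)] \<in> W8 7"
      unfolding WtH_def by (intro fs.span_diff; fold WtH_def) (auto intro!: delta_W8 simp: E8_def rank8_def)
    show "(0 :: word \<Rightarrow> 'k) \<in> F8 7" unfolding FTlt_def by (rule fs.span_zero)
  qed (use span_gens_ideal[OF quadratic_gens(3)] in auto)
  moreover have "delta ([] @ (7,6) # [(6,3)]) - delta ([] @ (7,5) # [(6,3)]) \<in> (L8 :: (word \<Rightarrow> 'k) set)"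
    by (rule lead_swap) (auto simp: E8_def)
  ultimately show ?thesis using fs.subspace_add[OF subspace_L8] by fastforce
qed

text \<open>In the quadratic relation at \<open>x\<close> the top weight is 5 = 3 + 2; all words
  ending in \<open>(1,0)\<close> or \<open>(2,0)\<close> have lower weight.\<close>

lemma lead_x3:
  assumes x: "x = 5 \<or> x = 6"
  shows "delta [(x,3),(3,1)] - delta [(x,3),(4,2)] \<in> (L8 :: (word \<Rightarrow> 'k::field) set)"
proof -
  have "delta [(x,3),(3,1)] - delta [(x,4),(4,2)] \<in> (L8 :: (word \<Rightarrow> 'k) set)"
  proof (rule L8_I[where n = 5])
    show "delta [(x,3),(3,1)] - delta [(x,4),(4,2)] \<in> W8 5"
      unfolding WtH_def by (intro fs.span_diff; fold WtH_def) (use x in \<open>auto intro!: delta_W8 simp: E8_def rank8_def\<close>)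
    show "delta [(x,3),(3,1)] + delta [(x,3),(1,0)] + delta [(3,1),(1,0)]
    - (delta [(x,4),(4,2)] + delta [(x,4),(2,0)] + delta [(4,2),(2,0)]) \<in> I8"
      using x by (elim disjE) (simp_all only: span_gens_ideal[OF quadratic_gens(1)] span_gens_ideal[OF quadratic_gens(2)])
    show "delta [(x,4),(2,0)] + delta [(4,2),(2,0)] - (delta [(x,3),(1,0)] + delta [(3,1),(1,0)]) \<in> F8 5"
      unfolding FTlt_def by (intro fs.span_diff fs.span_add; fold FTlt_def)
        (use x in \<open>auto intro!: delta_F8 simp: E8_def rank8_def\<close>)
  qed (simp add: algebra_simps)
  moreover have "delta ([] @ (x,4) # [(4,2)]) - delta ([] @ (x,3) # [(4,2)]) \<in> (L8 :: (word \<Rightarrow> 'k) set)"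
    by (rule lead_swap) (use x in \<open>auto simp: E8_def\<close>)
  ultimately show ?thesis using fs.subspace_add[OF subspace_L8] by fastforce
qed

text \<open>A factor in \<open>L8\<close> has zero sum over the edges with any given source, so
  every function of the three sources defines a functional that kills the kernel. Both the cocycle
  and the stability of the kernel under the differential rest on this.\<close>

lemma TensK_fiber:
  assumes "z \<in> TensK E8 (L8 :: (word \<Rightarrow> 'k::field) set) 3"
  shows "(\<Sum>a\<in>E8. \<Sum>b\<in>E8. \<Sum>c\<in>E8. G (fst a) (fst b) (fst c) * z [[a], [b], [c]]) = 0"
proof -
  let ?T = "\<lambda>z :: tuple \<Rightarrow> 'k. \<Sum>a\<in>E8. \<Sum>b\<in>E8. \<Sum>c\<in>E8. G (fst a) (fst b) (fst c) * z [[a], [b], [c]]"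
  have "z \<in> {z. ?T z = 0}"
  proof (rule TensK_minimal[OF _ _ assms])
    show "fs.subspace {z. ?T z = 0}"
      by (rule subspace_functional_kernel, rule functionalI)
        (simp_all add: distrib_left sum.distrib sum_distrib_left mult_ac)
    fix fs :: "(word \<Rightarrow> 'k) list" assume "length fs = 3" and L: "\<exists>f\<in>set fs. f \<in> L8"
    then obtain f g h where fgh: "fs = [f, g, h]" by (auto simp: numeral_3_eq_3 length_Suc_conv)
    have T: "?T (tens fs) = (\<Sum>a\<in>E8. \<Sum>b\<in>E8. \<Sum>c\<in>E8. G (fst a) (fst b) (fst c) * (f [a] * g [b] * h [c]))"
      by (simp add: fgh tens_3)
    from L fgh consider "f \<in> L8" | "g \<in> L8" | "h \<in> L8" by auto
    then have "?T (tens fs) = 0"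
    proof cases
      case 1
      have "?T (tens fs) = (\<Sum>b\<in>E8. \<Sum>a\<in>E8. \<Sum>c\<in>E8. G (fst a) (fst b) (fst c) * (f [a] * g [b] * h [c]))"
        unfolding T by (rule sum.swap)
      also have "\<dots> = (\<Sum>b\<in>E8. \<Sum>c\<in>E8. \<Sum>a\<in>E8. G (fst a) (fst b) (fst c) * (f [a] * g [b] * h [c]))"
        by (rule sum.cong[OF refl]) (rule sum.swap)
      also have "\<dots> = (\<Sum>b\<in>E8. \<Sum>c\<in>E8. (g [b] * h [c]) * (\<Sum>a\<in>E8. G (fst a) (fst b) (fst c) * f [a]))"
        by (simp add: sum_distrib_left mult_ac)
      also have "\<dots> = 0"
        by (simp add: lead_fiber[OF 1, of "\<lambda>s. G s (fst _) (fst _)"])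
      finally show ?thesis .
    next
      case 2
      have "?T (tens fs) = (\<Sum>a\<in>E8. \<Sum>c\<in>E8. \<Sum>b\<in>E8. G (fst a) (fst b) (fst c) * (f [a] * g [b] * h [c]))"
        unfolding T by (rule sum.cong[OF refl]) (rule sum.swap)
      also have "\<dots> = (\<Sum>a\<in>E8. \<Sum>c\<in>E8. (f [a] * h [c]) * (\<Sum>b\<in>E8. G (fst a) (fst b) (fst c) * g [b]))"
        by (simp add: sum_distrib_left mult_ac)
      also have "\<dots> = 0"
        by (simp add: lead_fiber[OF 2, of "\<lambda>s. G (fst _) s (fst _)"])
      finally show ?thesis .
    next
      case 3
      have "?T (tens fs) = (\<Sum>a\<in>E8. \<Sum>b\<in>E8. (f [a] * g [b]) * (\<Sum>c\<in>E8. G (fst a) (fst b) (fst c) * h [c]))"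
        unfolding T by (simp add: sum_distrib_left mult_ac)
      also have "\<dots> = 0"
        by (simp add: lead_fiber[OF 3, of "G (fst _) (fst _)"])
      finally show ?thesis .
    qed
    then show "tens fs \<in> {z. ?T z = 0}" by simp
  qed
  then show ?thesis by simp
qed

lemma delta_pair: "delta [u, v] = tens [delta u, delta v]"
  by (rule tens_2_eqI) (auto simp: tens_2 tens_length delta_apply)

lemma tens_2_diff_left: "tens [f - f', g] = tens [f, g] - tens [f', g]"
  and tens_2_diff_right: "tens [f, g - g'] = tens [f, g] - tens [f, g']"
  by (rule tens_2_eqI; simp add: tens_2 tens_length algebra_simps)+

lemma TensK_2_I:
  assumes "f \<in> Tpos E" "g \<in> Tpos E" "f \<in> J \<or> g \<in> J"
  shows "tens [f, g] \<in> TensK E J 2"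
  using assms by (intro TensK_I) auto

lemma TensK_2_swap:
  assumes "u \<noteq> []" "v \<noteq> []" "set (u @ u' @ v @ v') \<subseteq> E" "u' \<noteq> []" "v' \<noteq> []"
    and "delta u - delta u' \<in> J" "delta v - delta v' \<in> (J :: (word \<Rightarrow> 'k::field) set)"
  shows "delta [u, v] - delta [u', v'] \<in> TensK E J 2"
proof -
  have "delta [u, v] - delta [u', v'] = tens [delta u - delta u', delta v] + tens [delta u', delta v - (delta v' :: word \<Rightarrow> 'k)]"
    by (simp add: delta_pair tens_2_diff_left tens_2_diff_right)
  moreover have "\<dots> \<in> TensK E J 2"
    using assms by (intro fs.subspace_add[OF subspace_TensK] TensK_2_I fs.subspace_diff[OF subspace_Tpos] delta_Tpos) auto
  ultimately show ?thesis by simp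
qed

lemma bar_d_same_sources:
  assumes "{a, b, c, a', b', c'} \<subseteq> E8" "fst a = fst a'" "fst b = fst b'" "fst c = fst c'"
  shows "bar_d (delta [[a], [b], [c]]) - bar_d (delta [[a'], [b'], [c']]) \<in> TensK E8 (L8 :: (word \<Rightarrow> 'k::field) set) 2"
proof -
  have one: "delta [e] - delta [e'] \<in> (L8 :: (word \<Rightarrow> 'k) set)" if "e \<in> E8" "e' \<in> E8" "fst e = fst e'" for e e'
    using lead_swap[OF that, of "[]" "[]"] by simp
  have two: "delta [e, f] - delta [e', f'] \<in> (L8 :: (word \<Rightarrow> 'k) set)"
    if "e \<in> E8" "e' \<in> E8" "fst e = fst e'" "f \<in> E8" "f' \<in> E8" "fst f = fst f'" for e e' f f'
    using fs.subspace_add[OF subspace_L8 lead_swap[OF that(1-3), of "[]" "[f]"] lead_swap[OF that(4-6), of "[e']" "[]"]] that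
    by simp
  have "bar_d (delta [[a], [b], [c]]) - bar_d (delta [[a'], [b'], [c']])
    = (delta [[a], [b, c]] - delta [[a'], [b', c']]) - (delta [[a, b], [c]] - (delta [[a', b'], [c']] :: tuple \<Rightarrow> 'k))"
    by (simp add: bar_d_delta_3)
  moreover have "\<dots> \<in> TensK E8 L8 2"
    using assms by (intro fs.subspace_diff[OF subspace_TensK] TensK_2_swap one two) auto
  ultimately show ?thesis by simp
qed

text \<open>A representative edge for each source, namely the first edge of its chosen path.\<close>

definition down8 :: "nat \<Rightarrow> edge" where
  "down8 s = (s, if s = 3 then 1 else if s = 4 then 2 else if s = 5 \<or> s = 6 then 3 else if s = 7 then 5 else 0)"

lemma down8_E8: "e \<in> E8 \<Longrightarrow> down8 (fst e) \<in> E8" "fst (down8 s) = s"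
  by (auto simp: down8_def E8_def)

lemma bar_d_expand_3_3:
  assumes "x \<in> BarV E 3 3" "finite E"
  shows "bar_d x = (\<Sum>a\<in>E. \<Sum>b\<in>E. \<Sum>c\<in>E. fsc (x [[a], [b], [c]]) (bar_d (delta [[a], [b], [c]])))"
proof -
  have "bar_d x = (\<Sum>t\<in>Bas E 3 3. fsc (x t) (bar_d (delta t)))"
    using assms by (intro bar_d_expand) (auto simp: finite_Bas BarV_eq)
  then show ?thesis by (simp add: sum_Bas_3_3)
qed

text \<open>Modulo the kernel the differential of a triple of edges depends only on the sources. So
  \<open>bar_d z\<close> is congruent to a combination of the \<open>C p q r\<close> whose
  coefficients are sums of \<open>z\<close> over triples with given sources, and these sums
  vanish.\<close>

lemma bar_d_BarK_L8: "bar_d ` BarK E8 (L8 :: (word \<Rightarrow> 'k::field) set) 3 3 \<subseteq> BarK E8 L8 2 3"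
proof clarify
  fix z :: "tuple \<Rightarrow> 'k" assume z: "z \<in> BarK E8 L8 3 3"
  then have zV: "z \<in> BarV E8 3 3" and zT: "z \<in> TensK E8 L8 3"
    using BarK_subset_BarV[of E8 L8 3 3] by (auto simp: BarK_TensK)
  define C where "C p q r = (bar_d (delta [[down8 p], [down8 q], [down8 r]]) :: tuple \<Rightarrow> 'k)" for p q r
  have 0: "(\<Sum>a\<in>E8. \<Sum>b\<in>E8. \<Sum>c\<in>E8. fsc (z [[a], [b], [c]]) (C (fst a) (fst b) (fst c))) = 0"
  proof
    fix s
    show "(\<Sum>a\<in>E8. \<Sum>b\<in>E8. \<Sum>c\<in>E8. fsc (z [[a], [b], [c]]) (C (fst a) (fst b) (fst c))) s = 0 s"
      using TensK_fiber[OF zT, of "\<lambda>p q r. C p q r s"] by (simp add: sum_fun_apply mult.commute)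
  qed
  have "bar_d z = (\<Sum>a\<in>E8. \<Sum>b\<in>E8. \<Sum>c\<in>E8.
      fsc (z [[a], [b], [c]]) (bar_d (delta [[a], [b], [c]]) - C (fst a) (fst b) (fst c)))"
    using bar_d_expand_3_3[OF zV] 0 by (simp add: fs.scale_right_diff_distrib sum_subtractf)
  moreover have "\<dots> \<in> TensK E8 L8 2"
    unfolding C_def
    by (intro fs.subspace_sum[OF subspace_TensK] fs.subspace_scale[OF subspace_TensK] bar_d_same_sources)
      (auto simp: down8_E8(2) intro: down8_E8(1)[of "(_, _)", simplified])
  moreover have "bar_d z \<in> BarV E8 2 3"
    using bar_d_BarV[of E8 z 2 3] zV by simp
  ultimately show "bar_d z \<in> BarK E8 L8 2 3"
    using BarV_Deg[of E8 2 3] by (auto simp: BarK_TensK)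
qed

section \<open>An explicit cycle and a dual cocycle\<close>

definition cycle8 :: "tuple \<Rightarrow> 'k::field" where
  "cycle8 = delta [[(7,5)], [(5,3)], [(3,1)]] - delta [[(7,5)], [(5,3)], [(4,2)]]
    - delta [[(7,5)], [(6,3)], [(3,1)]] + delta [[(7,5)], [(6,3)], [(4,2)]]"

lemma delta_BarV: "t \<in> Bas E i j \<Longrightarrow> delta t \<in> BarV E i j"
  unfolding BarV_def by (rule fs.span_base) simp

lemma cycle8_BarV: "cycle8 \<in> BarV E8 3 3"
proof -
  have "fs.subspace (BarV E8 3 3 :: (tuple \<Rightarrow> 'k::field) set)" unfolding BarV_def by (rule fs.subspace_span)
  then show ?thesis unfolding cycle8_def
    by (intro fs.subspace_add fs.subspace_diff delta_BarV) (simp_all add: Bas_def E8_def)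
qed

text \<open>With each vertex standing for its edge under \<open>down8\<close>, \<open>cycle8\<close>
  is the tensor \<open>7 | (5 - 6) | (3 - 4)\<close>. Merging the last two factors gives the
  difference of the leading terms at 5 and 6, merging the first two gives the leading term at
  7.\<close>

lemma bar_d_cycle8:
  "bar_d cycle8 =
    tens [delta [(7,5)], (delta [(5,3),(3,1)] - delta [(5,3),(4,2)]) - (delta [(6,3),(3,1)] - delta [(6,3),(4,2)])]
    - (tens [delta [(7,5),(5,3)] - delta [(7,5),(6,3)], delta [(3,1)] - delta [(4,2)]] :: tuple \<Rightarrow> 'k::field)"
proof -
  let ?A = "{[[(7,5)], [(5,3)], [(3,1)]], [[(7,5)], [(5,3)], [(4,2)]],
    [[(7,5)], [(6,3)], [(3,1)]], [[(7,5)], [(6,3)], [(4,2)]]} :: tuple set"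
  have "bar_d cycle8 = (\<Sum>t\<in>?A. fsc (cycle8 t) (bar_d (delta t) :: tuple \<Rightarrow> 'k))"
    by (rule bar_d_expand) (auto simp: cycle8_def delta_apply)
  also have "\<dots> = bar_d (delta [[(7,5)], [(5,3)], [(3,1)]]) - bar_d (delta [[(7,5)], [(5,3)], [(4,2)]])
    - bar_d (delta [[(7,5)], [(6,3)], [(3,1)]]) + bar_d (delta [[(7,5)], [(6,3)], [(4,2)]])"
    by (simp add: cycle8_def delta_apply algebra_simps)
  also have "\<dots> = tens [delta [(7,5)], (delta [(5,3),(3,1)] - delta [(5,3),(4,2)]) - (delta [(6,3),(3,1)] - delta [(6,3),(4,2)])]
    - tens [delta [(7,5),(5,3)] - delta [(7,5),(6,3)], delta [(3,1)] - delta [(4,2)]]"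
    by (simp only: bar_d_delta_3 delta_pair tens_2_diff_left tens_2_diff_right) (simp add: algebra_simps)
  finally show ?thesis .
qed

lemma cycle8_TorZ: "cycle8 \<in> TorZ E8 (L8 :: (word \<Rightarrow> 'k::field) set) 3 3"
proof -
  have L: "(delta [(5,3),(3,1)] - delta [(5,3),(4,2)]) - (delta [(6,3),(3,1)] - delta [(6,3),(4,2)])
      \<in> (L8 :: (word \<Rightarrow> 'k) set)"
    by (rule fs.subspace_diff[OF subspace_L8 lead_x3 lead_x3]) simp_all
  have "bar_d cycle8 \<in> TensK E8 (L8 :: (word \<Rightarrow> 'k) set) 2"
    unfolding bar_d_cycle8
  proof (rule fs.subspace_diff[OF subspace_TensK TensK_2_I TensK_2_I])
    note T = delta_Tpos and D = fs.subspace_diff[OF subspace_Tpos]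
    show "delta [(7,5)] \<in> (Tpos E8 :: (word \<Rightarrow> 'k) set)" by (rule T) (simp_all add: E8_def)
    show "(delta [(5,3),(3,1)] - delta [(5,3),(4,2)]) - (delta [(6,3),(3,1)] - delta [(6,3),(4,2)])
        \<in> (Tpos E8 :: (word \<Rightarrow> 'k) set)"
      by (rule D[OF D[OF T T] D[OF T T]]) (simp_all add: E8_def)
    show "delta [(7,5),(5,3)] - delta [(7,5),(6,3)] \<in> (Tpos E8 :: (word \<Rightarrow> 'k) set)"
      "delta [(3,1)] - delta [(4,2)] \<in> (Tpos E8 :: (word \<Rightarrow> 'k) set)"
      by (rule D[OF T T]; simp add: E8_def)+
  qed (rule disjI2[OF L], rule disjI1[OF lead_75])
  moreover have "bar_d cycle8 \<in> (BarV E8 2 3 :: (tuple \<Rightarrow> 'k) set)"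
    using bar_d_BarV[of E8 cycle8 2 3] cycle8_BarV by simp
  ultimately show ?thesis
    using cycle8_BarV BarV_Deg[of E8 2 3] by (auto simp: TorZ_def BarK_TensK)
qed

text \<open>As a function of the sources alone it vanishes on the kernel, and of the four terms of
  \<open>cycle8\<close> it sees only the first.\<close>

definition cocycle8 :: "tuple \<Rightarrow> 'k::field" where
  "cocycle8 t = (if t \<in> Bas E8 3 3 \<and> map (\<lambda>w. fst (hd w)) t = [7, 5, 3] then 1 else 0)"

lemma cocycle8_HomC: "cocycle8 \<in> HomC E8 (L8 :: (word \<Rightarrow> 'k::field) set) 3 3"
proof -
  have "pairing E8 3 3 cocycle8 k = 0" if "k \<in> BarK E8 L8 3 3" for k :: "tuple \<Rightarrow> 'k"
  proof -
    have "k \<in> TensK E8 L8 3" using that by (simp add: BarK_TensK)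
    from TensK_fiber[OF this, of "\<lambda>p q r. if p = 7 \<and> q = 5 \<and> r = 3 then 1 else 0"]
    show ?thesis by (simp add: pairing_def sum_Bas_3_3 cocycle8_def Bas_3_3_iff cong: sum.cong)
  qed
  then show ?thesis by (simp add: HomC_def cocycle8_def)
qed

lemma pairing_delta: "finite E \<Longrightarrow> t \<in> Bas E i j \<Longrightarrow> pairing E i j g (delta t) = g t"
  by (simp add: pairing_def delta_apply finite_Bas if_distrib cong: if_cong)

lemma pairing_cycle8: "pairing E8 3 3 cocycle8 cycle8 = (1 :: 'k::field)"
proof -
  note p = functional_add[OF functional_pairing] functional_diff[OF functional_pairing]
  show ?thesis
    by (simp add: cycle8_def p pairing_delta Bas_3_3_iff E8_def cocycle8_def)
qed

theorem theorem1p3: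
  shows "\<exists>(V :: nat set) le z0. ranked_poset V le z0 \<and>
    \<not> bigraded_iso (gr_ext_dim V le z0 TYPE('k::field)) (ext_dim_A' V le z0 TYPE('k)) \<and>
    \<not> bigraded_iso (gr_tor_dim V le z0 TYPE('k)) (tor_dim_A' V le z0 TYPE('k))"
proof (intro exI conjI)
  have zero: "gr_tor_dim V8 le8 0 TYPE('k) 3 3 = 0" "gr_ext_dim V8 le8 0 TYPE('k) 3 3 = 0"
    using gr_dims_zero[of V8 le8 0 2 3, where 'k = 'k] TorZ_subset_TorB[where 'k = 'k]
    by (simp_all add: Edges_V8)
  have "tor_dim E8 (L8 :: (word \<Rightarrow> 'k) set) 3 3 > 0" "ext_dim E8 (L8 :: (word \<Rightarrow> 'k) set) 3 3 > 0"
    using tor_ext_dim_pos[of E8 2 3 "L8 :: (word \<Rightarrow> 'k) set" cocycle8 cycle8]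
      Bas_4_3[of E8] bar_d_BarK_L8[where 'k = 'k] cocycle8_HomC[where 'k = 'k] cycle8_TorZ[where 'k = 'k]
      pairing_cycle8[where 'k = 'k] by simp_all
  then have pos: "tor_dim_A' V8 le8 0 TYPE('k) 3 3 > 0" "ext_dim_A' V8 le8 0 TYPE('k) 3 3 > 0"
    by (simp_all add: tor_dim_A'_def ext_dim_A'_def Edges_V8)
  show "ranked_poset V8 le8 0" by (rule ranked_V8)
  show "\<not> bigraded_iso (gr_ext_dim V8 le8 0 TYPE('k)) (ext_dim_A' V8 le8 0 TYPE('k))"
    using zero(2) pos(2) unfolding bigraded_iso_def by (metis less_irrefl)
  show "\<not> bigraded_iso (gr_tor_dim V8 le8 0 TYPE('k)) (tor_dim_A' V8 le8 0 TYPE('k))"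
    using zero(1) pos(1) unfolding bigraded_iso_def by (metis less_irrefl)
qed

end
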